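(* Let $E$ be a separable Banach space, $1<p<\infty$, $p^{-1}+q^{-1}=1$. Let $x_0\in L_p(\Omega,E)$ with $I_f(x_0)$ finite, where $f:\Omega\times E\to\mathbb{R}$ is a measurable integrand such that there exist a positive constant $c$ and a non negative function $a\in L_q(\Omega,\mathbb{R})$ with, for almost every $\omega$, for every $e\in E$ and every $e^*\in\partial^Cf_\omega(e)$, $$\|e^*\|_*\le c\|e\|^{p-1}+a(\omega).$$ Then $$L_q(\partial^Ff(x_0))_{\sigma^*}\subset\partial^FI_f(x_0).$$
   Context: $(\Omega,\mathbb{T},\mu)$ is a measure space with $\mu$ a $\sigma$-finite positive measure and $\mathbb{T}$ $\mu$-complete. A measurable integrand is a $\mathbb{T}\otimes\mathcal{B}(E)$-measurable function on $\Omega\times E$, where $\mathcal{B}(E)$ is the Borel tribe of $E$; $f_\omega=f(\omega,\cdot)$. $I_f(x)=\int^*_\Omega f(\omega,x(\omega))\,d\mu(\omega)$, considered on $L_p(\Omega,E)$, with $\int^*_\Omega v\,d\mu=\inf\{\int_\Omega u\,d\mu: u\in L_1(\Omega,\mathbb{R}),\ u\ge v\text{ a.e.}\}$. $\partial^C$ denotes the Clarke subdifferential, and $\|\cdot\|_*$ the dual norm on $E^*$. For a function $J$ on a normed space $Y$ finite at $y_0$, the Fréchet subdifferential is $\partial^FJ(y_0)=\{y^*\in Y^*: \liminf_{y\to y_0}\frac{J(y)-J(y_0)-\langle y^*,y-y_0\rangle}{\|y-y_0\|}\ge0\}$. $L_q(\Omega,E^*_{\sigma^*})$ is the set of classes of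 scalarly measurable $x^*:\Omega\to E^*$ with $\|x^*\|_*\in L_q(\Omega,\mathbb{R})$; it is the dual of $L_p(\Omega,E)$ via $\langle x^*,x\rangle=\int_\Omega\langle x^*(\omega),x(\omega)\rangle\,d\mu$. $L_q(\partial^Ff(x_0))_{\sigma^*}$ is the set of $x^*\in L_q(\Omega,E^*_{\sigma^*})$ with $x^*(\omega)\in\partial^Ff_\omega(x_0(\omega))$ for almost every $\omega$. *)

theory Defs
  imports "HOL-Analysis.Analysis"
begin

text \<open>
  The dual space of \<open>E\<close> is the type of bounded linear maps \<open>'e \<Rightarrow>\<^sub>L real\<close>, whose norm is the
  dual norm.  Elements of Lebesgue spaces are handled through representatives: \<open>Lp_norm\<close> is a
  seminorm on the carrier \<open>Lp\<close>, vanishing exactly on the functions that are zero almost everywhere.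
  For a separable space \<open>E\<close>, Borel and strong measurability agree.
\<close>

definition Lp :: "'w measure \<Rightarrow> real \<Rightarrow> ('w \<Rightarrow> 'e::{banach, second_countable_topology}) set" where
  "Lp M p = {x \<in> borel_measurable M. integrable M (\<lambda>\<omega>. norm (x \<omega>) powr p)}"

definition Lp_norm :: "'w measure \<Rightarrow> real \<Rightarrow> ('w \<Rightarrow> 'e::{banach, second_countable_topology}) \<Rightarrow> real" where
  "Lp_norm M p x = (\<integral>\<omega>. norm (x \<omega>) powr p \<partial>M) powr (1 / p)"

text \<open>The filter of punctured neighbourhoods of \<open>x0\<close> in \<open>Lp\<close>.\<close>

definition Lp_at :: "'w measure \<Rightarrow> real \<Rightarrow> ('w \<Rightarrow> 'e::{banach, second_countable_topology})
    \<Rightarrow> ('w \<Rightarrow> 'e) filter" where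
  "Lp_at M p x0 = (INF r\<in>{0<..}. principal
     {x \<in> Lp M p. 0 < Lp_norm M p (\<lambda>\<omega>. x \<omega> - x0 \<omega>) \<and> Lp_norm M p (\<lambda>\<omega>. x \<omega> - x0 \<omega>) < r})"

text \<open>
  Continuous linear functionals on \<open>Lp\<close>; the values outside the carrier are irrelevant.  The bound
  makes such a functional constant on classes of almost everywhere equal functions.
\<close>

definition Lp_dual :: "'w measure \<Rightarrow> real
    \<Rightarrow> (('w \<Rightarrow> 'e::{banach, second_countable_topology}) \<Rightarrow> real) set" where
  "Lp_dual M p = {l.
     (\<forall>x\<in>Lp M p. \<forall>y\<in>Lp M p. l (\<lambda>\<omega>. x \<omega> + y \<omega>) = l x + l y) \<and>
     (\<forall>x\<in>Lp M p. \<forall>s. l (\<lambda>\<omega>. s *\<^sub>R x \<omega>) = s * l x) \<and>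
     (\<exists>C. \<forall>x\<in>Lp M p. \<bar>l x\<bar> \<le> C * Lp_norm M p x)}"

text \<open>With the infimum in the extended reals, the upper integral is \<open>\<infinity>\<close> if \<open>v\<close> has no integrable
  majorant.\<close>

definition upper_integral :: "'w measure \<Rightarrow> ('w \<Rightarrow> real) \<Rightarrow> ereal" where
  "upper_integral M v =
     Inf {ereal (\<integral>\<omega>. u \<omega> \<partial>M) | u. integrable M u \<and> (AE \<omega> in M. v \<omega> \<le> u \<omega>)}"

definition integral_functional :: "'w measure \<Rightarrow> ('w \<Rightarrow> 'e \<Rightarrow> real) \<Rightarrow> ('w \<Rightarrow> 'e) \<Rightarrow> ereal" where
  "integral_functional M f x = upper_integral M (\<lambda>\<omega>. f \<omega> (x \<omega>))"

text \<open>
  Clarke's generalized directional derivative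
  \<open>g\<^sup>\<circ>(x; v) = limsup (g (y + t v) - g y) / t\<close> as \<open>y \<rightarrow> x\<close> (with \<open>y = x\<close> allowed) and \<open>t \<down> 0\<close>, and the
  associated subdifferential.  The derivative is extended-real valued, so no Lipschitz condition
  on \<open>g\<close> is needed for the definition.
\<close>

definition clarke_derivative :: "('e::real_normed_vector \<Rightarrow> real) \<Rightarrow> 'e \<Rightarrow> 'e \<Rightarrow> ereal" where
  "clarke_derivative g x v =
     Limsup (nhds x \<times>\<^sub>F at_right 0) (\<lambda>(y, t). ereal ((g (y + t *\<^sub>R v) - g y) / t))"

definition clarke_subdiff :: "('e::real_normed_vector \<Rightarrow> real) \<Rightarrow> 'e \<Rightarrow> ('e \<Rightarrow>\<^sub>L real) set" where
  "clarke_subdiff g x = {x'. \<forall>v. ereal (blinfun_apply x' v) \<le> clarke_derivative g x v}"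

definition frechet_subdiff :: "('e::real_normed_vector \<Rightarrow> ereal) \<Rightarrow> 'e \<Rightarrow> ('e \<Rightarrow>\<^sub>L real) set" where
  "frechet_subdiff J y0 = {y'. \<bar>J y0\<bar> \<noteq> \<infinity> \<and>
     0 \<le> Liminf (at y0)
       (\<lambda>y. (J y - J y0 - ereal (blinfun_apply y' (y - y0))) / ereal (norm (y - y0)))}"

text \<open>The same notion for functions on the space \<open>Lp\<close>, which is not a type.\<close>

definition Lp_frechet_subdiff :: "'w measure \<Rightarrow> real
    \<Rightarrow> (('w \<Rightarrow> 'e::{banach, second_countable_topology}) \<Rightarrow> ereal) \<Rightarrow> ('w \<Rightarrow> 'e)
    \<Rightarrow> (('w \<Rightarrow> 'e) \<Rightarrow> real) set" where
  "Lp_frechet_subdiff M p J x0 = {l \<in> Lp_dual M p. \<bar>J x0\<bar> \<noteq> \<infinity> \<and>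
     0 \<le> Liminf (Lp_at M p x0)
       (\<lambda>x. (J x - J x0 - ereal (l (\<lambda>\<omega>. x \<omega> - x0 \<omega>))) / ereal (Lp_norm M p (\<lambda>\<omega>. x \<omega> - x0 \<omega>)))}"

text \<open>Scalarly measurable maps into the dual whose dual norm is in \<open>L\<^sub>q\<close>.\<close>

definition Lq_weak_star :: "'w measure \<Rightarrow> real
    \<Rightarrow> ('w \<Rightarrow> ('e::{banach, second_countable_topology} \<Rightarrow>\<^sub>L real)) set" where
  "Lq_weak_star M q = {x'.
     (\<forall>e. (\<lambda>\<omega>. blinfun_apply (x' \<omega>) e) \<in> borel_measurable M) \<and> (\<lambda>\<omega>. norm (x' \<omega>)) \<in> Lp M q}"

definition Lq_selections :: "'w measure \<Rightarrow> real
    \<Rightarrow> ('w \<Rightarrow> ('e::{banach, second_countable_topology} \<Rightarrow>\<^sub>L real) set)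
    \<Rightarrow> ('w \<Rightarrow> ('e \<Rightarrow>\<^sub>L real)) set" where
  "Lq_selections M q G = {x' \<in> Lq_weak_star M q. AE \<omega> in M. x' \<omega> \<in> G \<omega>}"

text \<open>The pairing, by which an element of \<open>Lq_weak_star\<close> is regarded as a functional on \<open>Lp\<close>.\<close>

definition Lq_pairing :: "'w measure \<Rightarrow> ('w \<Rightarrow> ('e::{banach, second_countable_topology} \<Rightarrow>\<^sub>L real))
    \<Rightarrow> ('w \<Rightarrow> 'e) \<Rightarrow> real" where
  "Lq_pairing M x' x = (\<integral>\<omega>. blinfun_apply (x' \<omega>) (x \<omega>) \<partial>M)"

end

theory Submission
  imports Defs
begin

text \<open>
  Write \<open>\<rho>\<^sub>\<omega>(e) = f\<^sub>\<omega>(e) - f\<^sub>\<omega>(x0(\<omega>)) - \<langle>x'(\<omega>), e - x0(\<omega>)\<rangle>\<close> for the remainder in the pointwise Frechet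
  condition, and \<open>\<phi>\<close> for the negative part of \<open>\<rho>\<^sub>\<omega>(x(\<omega>)) / \<parallel>x(\<omega>) - x0(\<omega>)\<parallel>\<close>. For any integrable majorant of
  \<open>f(\<cdot>, x(\<cdot>))\<close> one obtains a majorant of \<open>f(\<cdot>, x0(\<cdot>))\<close>, and Hoelder's inequality gives
  \<open>I(x) - I(x0) - \<langle>x', x - x0\<rangle> \<ge> - \<parallel>\<phi>\<parallel>\<^sub>q \<parallel>x - x0\<parallel>\<^sub>p\<close>. So it is enough that \<open>\<parallel>\<phi>\<parallel>\<^sub>q\<close> becomes small along some subsequence of
  any sequence tending to \<open>x0\<close> in \<open>L\<^sub>p\<close>. Along a subsequence that converges almost everywhere, \<open>\<phi>\<close> tends
  to zero pointwise, by the Frechet condition. The limit passes to the norm if \<open>\<phi>\<close> is dominated by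
  \<open>c (\<parallel>x0\<parallel> + 2 \<parallel>x - x0\<parallel>)\<^sup>p\<^sup>-\<^sup>1 + a + \<parallel>x'\<parallel>\<close>, because \<open>(p - 1) q = p\<close>.
  
  The domination is the main difficulty. It amounts to the lower bound
  \<open>f\<^sub>\<omega>(e) \<ge> f\<^sub>\<omega>(x0) - K \<parallel>e - x0\<parallel>\<close>, where \<open>K\<close> bounds the Clarke subdifferentials on a ball
  (\<open>clarke_bounded_imp_lower_bound\<close>). The functions \<open>f\<^sub>\<omega>\<close> are only Borel: they need not be locally
  Lipschitz, and the hypothesis on the subdifferentials says nothing at points where these are
  empty. Two facts overcome this.
  
  First, Clarke's derivative \<open>v \<mapsto> g\<^sup>\<circ>(z; v)\<close> is sublinear with extended real values, and the
  Hahn--Banach theorem shows that the subdifferential at \<open>z\<close> can only be empty if \<open>g\<close> descends, uniformly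
  near \<open>z\<close>, at arbitrarily steep rates. If the subdifferentials were empty on an open set, a
  concatenation of steep descents would give a short translation under which \<open>g\<close> decreases by
  a large amount on an open set. A Borel function is bounded on a ball up to a meager set, and by the
  Baire category theorem this is impossible (\<open>clarke_bounded_imp_slope_ge\<close>).
  
  Second, it follows that close to every direction there is one in which \<open>g\<close> increases at a rate
  of at most about \<open>K\<close> (\<open>clarke_bounded_imp_slope_le\<close>). Walking in such directions from \<open>e\<close> towards \<open>x0\<close>, the
  values of \<open>g\<close> increase by at most about \<open>K \<parallel>e - x0\<parallel>\<close>, and Frechet subdifferentiability at \<open>x0\<close>
  contributes the lower semicontinuity with which the walk can be completed.
\<close>

section \<open>Linear functionals below a sublinear functional\<close>

text \<open>
  Homogeneity is required for positive factors only; the value at zero follows.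
\<close>

definition sublinear :: "('e::real_vector \<Rightarrow> real) \<Rightarrow> bool" where
  "sublinear q \<longleftrightarrow> (\<forall>x y. q (x + y) \<le> q x + q y) \<and> (\<forall>t>0. \<forall>x. q (t *\<^sub>R x) = t * q x)"

lemma sublinear_zero: "sublinear q \<Longrightarrow> q 0 = 0"
  unfolding sublinear_def by (metis mult_cancel_right1 numeral_eq_one_iff scaleR_zero_right semiring_norm(83) zero_less_numeral)

lemma sublinear_ge_minus: "sublinear q \<Longrightarrow> - q (- x) \<le> q x"
  using sublinear_zero[of q] unfolding sublinear_def by (metis add.right_inverse neg_le_iff_le minus_le_iff diff_minus_eq_add diff_ge_0_iff_ge add.commute)

text \<open>
  The infima taken below (over a ray, over a chain, and in an infimal convolution) are all sublinear
  for the same reason: the sets over which they run behave subadditively and homogeneously up to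
  making elements smaller.
\<close>

lemma sublinear_Inf:
  fixes A :: "'e::real_vector \<Rightarrow> real set"
  assumes ne: "\<And>x. A x \<noteq> {}" and bdd: "\<And>x. bdd_below (A x)"
    and add: "\<And>x y a b. a \<in> A x \<Longrightarrow> b \<in> A y \<Longrightarrow> \<exists>c\<in>A (x + y). c \<le> a + b"
    and hom: "\<And>x t a. 0 < t \<Longrightarrow> a \<in> A x \<Longrightarrow> \<exists>c\<in>A (t *\<^sub>R x). c \<le> t * a"
  shows "sublinear (\<lambda>x. Inf (A x))"
proof -
  have "Inf (A (x + y)) \<le> Inf (A x) + Inf (A y)" for x y
  proof -
    have "Inf (A (x + y)) - b \<le> a" if "a \<in> A x" "b \<in> A y" for a b
      using add[OF that] cInf_lower[OF _ bdd] by (smt (verit))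
    then have "Inf (A (x + y)) - b \<le> Inf (A x)" if "b \<in> A y" for b
      using that by (intro cInf_greatest[OF ne]) auto
    then have "Inf (A (x + y)) - Inf (A x) \<le> Inf (A y)"
      by (intro cInf_greatest[OF ne]) (auto simp: algebra_simps)
    then show ?thesis by simp
  qed
  moreover have le: "Inf (A (t *\<^sub>R x)) \<le> t * Inf (A x)" if "0 < t" for t x
  proof -
    have "Inf (A (t *\<^sub>R x)) / t \<le> a" if "a \<in> A x" for a
      using hom[OF \<open>0 < t\<close> that] cInf_lower[OF _ bdd, of _ "t *\<^sub>R x"] \<open>0 < t\<close>
      by (fastforce simp: field_simps)
    then have "Inf (A (t *\<^sub>R x)) / t \<le> Inf (A x)"
      by (intro cInf_greatest[OF ne])
    with \<open>0 < t\<close> show ?thesis by (simp add: field_simps)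
  qed
  moreover have "t * Inf (A x) \<le> Inf (A (t *\<^sub>R x))" if "0 < t" for t x
    using le[of "1 / t" "t *\<^sub>R x"] that by (simp add: field_simps)
  ultimately show ?thesis
    unfolding sublinear_def by (meson order_antisym)
qed

text \<open>
  The functional \<open>v \<mapsto> inf\<^bsub>t \<ge> 0\<^esub> q (v + t u) - t q u\<close> lies below \<open>q\<close>, and the choice \<open>t = 1\<close> at
  \<open>v = - u\<close> shows that it is odd at \<open>u\<close> up to an inequality. Applied to a minimal
  sublinear functional this gives oddness in every direction, hence linearity; applied to \<open>q\<close> itself
  it forces every smaller linear functional to agree with \<open>q\<close> at \<open>u\<close>.
\<close>

lemma sublinear_tilt:
  assumes q: "sublinear q"
  obtains r where "sublinear r" "\<And>v. r v \<le> q v" "r (- u) \<le> - q u"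
proof
  define A where "A = (\<lambda>v. {q (v + t *\<^sub>R u) - t * q u | t. 0 \<le> t})"
  have A0: "q v \<in> A v" for v
    unfolding A_def by (force intro: exI[of _ 0])
  have lower: "- q (- v) \<le> a" if a: "a \<in> A v" for a v
  proof -
    obtain t where t: "0 \<le> t" "a = q (v + t *\<^sub>R u) - t * q u"
      using a unfolding A_def by blast
    have "q (t *\<^sub>R u) = t * q u"
      using q t sublinear_zero[OF q] unfolding sublinear_def by (cases "t = 0") auto
    moreover have "q ((v + t *\<^sub>R u) + - v) \<le> q (v + t *\<^sub>R u) + q (- v)"
      using q unfolding sublinear_def by blast
    ultimately show ?thesis using t by simp
  qed
  then have bdd: "bdd_below (A v)" for v by (meson bdd_belowI)
  show "sublinear (\<lambda>v. Inf (A v))"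
  proof (rule sublinear_Inf)
    show "A x \<noteq> {}" for x using A0 by blast
    show "bdd_below (A x)" for x by (rule bdd)
    show "\<exists>c\<in>A (x + y). c \<le> a + b" if ab: "a \<in> A x" "b \<in> A y" for x y a b
    proof -
      obtain t s where "0 \<le> t" "a = q (x + t *\<^sub>R u) - t * q u" "0 \<le> s" "b = q (y + s *\<^sub>R u) - s * q u"
        using ab unfolding A_def by blast
      moreover have "q ((x + t *\<^sub>R u) + (y + s *\<^sub>R u)) \<le> q (x + t *\<^sub>R u) + q (y + s *\<^sub>R u)"
        using q unfolding sublinear_def by blast
      moreover have "(x + t *\<^sub>R u) + (y + s *\<^sub>R u) = x + y + (t + s) *\<^sub>R u"
        by (simp add: algebra_simps)
      ultimately show ?thesis
        unfolding A_def
        by (intro bexI[of _ "q (x + y + (t + s) *\<^sub>R u) - (t + s) * q u"])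
           (auto simp: algebra_simps intro: exI[of _ "t + s"])
    qed
    show "\<exists>c\<in>A (t *\<^sub>R x). c \<le> t * a" if t: "0 < t" and a: "a \<in> A x" for x t a
    proof -
      obtain s where s: "0 \<le> s" "a = q (x + s *\<^sub>R u) - s * q u"
        using a unfolding A_def by blast
      have "t * a = q (t *\<^sub>R x + (t * s) *\<^sub>R u) - (t * s) * q u"
        using q s t unfolding sublinear_def
        by (metis (no_types, lifting) mult.assoc right_diff_distrib scaleR_add_right scaleR_scaleR)
      with s t show ?thesis
        unfolding A_def by (intro bexI[of _ "t * a"]) (auto intro: exI[of _ "t * s"])
    qed
  qed
  show "Inf (A v) \<le> q v" for v by (rule cInf_lower[OF A0 bdd])
  have "q (- u + 1 *\<^sub>R u) - 1 * q u \<in> A (- u)"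
    unfolding A_def by (intro CollectI exI[of _ 1]) simp
  then show "Inf (A (- u)) \<le> - q u"
    using cInf_lower[OF _ bdd] sublinear_zero[OF q] by force
qed

text \<open>
  Zorn's lemma, with pointwise infima of chains as bounds. They are finite because
  \<open>r v \<ge> - r (- v) \<ge> - q (- v)\<close> for every member \<open>r\<close> of the chain.
\<close>

lemma sublinear_minimal:
  fixes q :: "'e::real_vector \<Rightarrow> real"
  assumes q: "sublinear q"
  obtains m where "sublinear m" "\<And>v. m v \<le> q v"
    "\<And>r. sublinear r \<Longrightarrow> (\<And>v. r v \<le> m v) \<Longrightarrow> r = m"
proof -
  define S where "S = {r. sublinear r \<and> (\<forall>v. r v \<le> q v)}"
  define P where "P = (\<lambda>r s :: 'e \<Rightarrow> real. \<forall>v. s v \<le> r v)"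
  have po: "partial_order_on S (relation_of P S)"
    by (rule partial_order_on_relation_ofI) (auto simp: P_def fun_eq_iff intro: order_trans order_antisym)
  have "\<exists>u\<in>S. \<forall>a\<in>C. P a u" if C: "C \<in> Chains (relation_of P S)" for C
  proof (cases "C = {}")
    case True
    then show ?thesis using q by (auto simp: S_def)
  next
    case False
    have CS: "C \<subseteq> S" and tot: "\<And>r s. r \<in> C \<Longrightarrow> s \<in> C \<Longrightarrow> P r s \<or> P s r"
      using C unfolding Chains_def relation_of_def by auto
    define A where "A = (\<lambda>v. (\<lambda>r. r v) ` C)"
    have "- q (- v) \<le> r v" if "r \<in> C" for r v
    proof -
      have "- r (- v) \<le> r v" "r (- v) \<le> q (- v)"
        using that CS sublinear_ge_minus[of r v] by (auto simp: S_def)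
      then show ?thesis by linarith
    qed
    then have bdd: "bdd_below (A v)" for v
      unfolding A_def by (force intro: bdd_belowI)
    have sub: "sublinear (\<lambda>v. Inf (A v))"
    proof (rule sublinear_Inf)
      show "A x \<noteq> {}" for x using False by (simp add: A_def)
      show "bdd_below (A x)" for x by (rule bdd)
      show "\<exists>c\<in>A (x + y). c \<le> a + b" if ab: "a \<in> A x" "b \<in> A y" for x y a b
      proof -
        obtain r s where rs: "r \<in> C" "a = r x" "s \<in> C" "b = s y"
          using ab unfolding A_def by blast
        obtain k where k: "k \<in> C" "k x \<le> r x" "k y \<le> s y"
          using tot[OF rs(1,3)] rs unfolding P_def by blast
        have "k (x + y) \<le> k x + k y"
          using k(1) CS unfolding S_def sublinear_def by blast
        with k rs show ?thesis
          unfolding A_def by (intro bexI[of _ "k (x + y)"]) auto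
      qed
      show "\<exists>c\<in>A (t *\<^sub>R x). c \<le> t * a" if t: "0 < t" and a: "a \<in> A x" for x t a
      proof -
        obtain r where r: "r \<in> C" "a = r x" using a unfolding A_def by blast
        have "r (t *\<^sub>R x) = t * r x"
          using r CS t unfolding S_def sublinear_def by blast
        moreover have "r (t *\<^sub>R x) \<in> A (t *\<^sub>R x)" using r by (simp add: A_def)
        ultimately show ?thesis using r by (intro bexI[of _ "r (t *\<^sub>R x)"]) auto
      qed
    qed
    have low: "Inf (A v) \<le> r v" if "r \<in> C" for r v
      by (rule cInf_lower[OF _ bdd]) (use that in \<open>auto simp: A_def\<close>)
    obtain r where "r \<in> C" using False by blast
    with low CS have "Inf (A v) \<le> q v" for v
      unfolding S_def using order_trans by blast
    with sub low show ?thesis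
      unfolding S_def P_def by (intro bexI[of _ "\<lambda>v. Inf (A v)"]) auto
  qed
  from predicate_Zorn[OF po this] obtain m where m: "m \<in> S" "\<And>a. a \<in> S \<Longrightarrow> P m a \<Longrightarrow> a = m"
    by blast
  show thesis
  proof
    show "sublinear m" "m v \<le> q v" for v using m by (auto simp: S_def)
    show "r = m" if "sublinear r" "\<And>v. r v \<le> m v" for r
    proof (rule m(2))
      have "r v \<le> q v" for v
        using that(2)[of v] m(1) unfolding S_def by (auto intro: order_trans)
      then show "r \<in> S" using that(1) by (simp add: S_def)
      show "P m r" using that(2) by (simp add: P_def)
    qed
  qed
qed

text \<open>
  A form of the Hahn--Banach theorem: a minimal sublinear functional is odd, by tilting it in an
  arbitrary direction, and an odd sublinear functional is linear.
\<close>

lemma hahn_banach_sublinear: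
  fixes q :: "'e::real_vector \<Rightarrow> real"
  assumes q: "sublinear q"
  obtains l where "linear l" "\<And>v. l v \<le> q v" "l u = q u"
proof -
  obtain r where r: "sublinear r" "\<And>v. r v \<le> q v" "r (- u) \<le> - q u"
    using sublinear_tilt[OF q] by blast
  obtain l where l: "sublinear l" "\<And>v. l v \<le> r v"
      "\<And>s. sublinear s \<Longrightarrow> (\<And>v. s v \<le> l v) \<Longrightarrow> s = l"
    using sublinear_minimal[OF r(1)] by blast
  have odd: "l (- v) = - l v" for v
  proof -
    obtain s where s: "sublinear s" "\<And>w. s w \<le> l w" "s (- v) \<le> - l v"
      using sublinear_tilt[OF l(1)] by blast
    with l(3)[OF s(1,2)] sublinear_ge_minus[OF l(1), of "- v"] show ?thesis by simp
  qed
  have add: "l (x + y) = l x + l y" for x y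
  proof -
    have "l (x + y) \<le> l x + l y" "l (- x + - y) \<le> l (- x) + l (- y)"
      using l(1) unfolding sublinear_def by blast+
    moreover have "l (- x + - y) = - l (x + y)" using odd[of "x + y"] by simp
    ultimately show ?thesis using odd[of x] odd[of y] by simp
  qed
  have "l (t *\<^sub>R x) = t * l x" for t x
  proof -
    have pos: "l (t *\<^sub>R x) = t * l x" if "0 < t" for t
      using l(1) that unfolding sublinear_def by blast
    consider "t > 0" | "t = 0" | "t < 0" by linarith
    then show ?thesis
      using pos[of t] pos[of "- t"] odd[of "t *\<^sub>R x"] sublinear_zero[OF l(1)] by cases auto
  qed
  with add have lin: "linear l" by (intro linearI) auto
  have le: "l v \<le> q v" for v using l(2) r(2) order_trans by blast
  have "q u \<le> l u" using l(2)[of "- u"] r(3) odd[of u] by linarith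
  with le have "l u = q u" by (simp add: order_antisym)
  with lin le show thesis using that by blast
qed

section \<open>Baire category and Borel functions\<close>

definition meager :: "'a::topological_space set \<Rightarrow> bool" where
  "meager A \<longleftrightarrow> (\<exists>F::nat \<Rightarrow> 'a set. (\<forall>n. closed (F n) \<and> interior (F n) = {}) \<and> A \<subseteq> (\<Union>n. F n))"

lemma meager_subset: "meager B \<Longrightarrow> A \<subseteq> B \<Longrightarrow> meager A"
  unfolding meager_def by (meson order_trans)

lemma meager_nowhere_dense: "closed A \<Longrightarrow> interior A = {} \<Longrightarrow> meager A"
  unfolding meager_def by (intro exI[of _ "\<lambda>_. A"]) auto

lemma meager_UN:
  fixes A :: "nat \<Rightarrow> 'a::topological_space set"
  assumes "\<And>n. meager (A n)"
  shows "meager (\<Union>n. A n)"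
proof -
  obtain F :: "nat \<Rightarrow> nat \<Rightarrow> 'a set" where F: "\<And>n k. closed (F n k) \<and> interior (F n k) = {}" "\<And>n. A n \<subseteq> (\<Union>k. F n k)"
    using assms unfolding meager_def by metis
  define G where "G = (\<lambda>i. F (fst (prod_decode i)) (snd (prod_decode i)))"
  have "A n \<subseteq> (\<Union>i. G i)" for n
  proof
    fix x assume "x \<in> A n"
    then obtain k where "x \<in> F n k" using F(2) by blast
    then have "x \<in> G (prod_encode (n, k))" by (simp add: G_def)
    then show "x \<in> (\<Union>i. G i)" by blast
  qed
  moreover have "closed (G i) \<and> interior (G i) = {}" for i using F(1) by (simp add: G_def)
  ultimately show ?thesis unfolding meager_def by blast
qed

lemma meager_Un:
  assumes "meager A" "meager B"
  shows "meager (A \<union> B)"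
proof -
  have "meager (\<Union>n::nat. if n = 0 then A else B)"
    by (rule meager_UN) (use assms in auto)
  then show ?thesis by (rule meager_subset) (auto intro: exI[of _ 1])
qed

lemma meager_translation:
  fixes A :: "'a::real_normed_vector set"
  assumes "meager A"
  shows "meager ((+) c ` A)"
proof -
  obtain F :: "nat \<Rightarrow> 'a set" where F: "\<And>n. closed (F n) \<and> interior (F n) = {}" "A \<subseteq> (\<Union>n. F n)"
    using assms unfolding meager_def by blast
  then have "closed ((+) c ` F n) \<and> interior ((+) c ` F n) = {}" for n
    by (simp add: closed_translation interior_translation)
  moreover have "(+) c ` A \<subseteq> (\<Union>n. (+) c ` F n)" using F(2) by blast
  ultimately show ?thesis unfolding meager_def by (intro exI[of _ "\<lambda>n. (+) c ` F n"]) blast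
qed

lemma baire_category_open:
  fixes A :: "'a::complete_space set"
  assumes "meager A" "open U" "U \<subseteq> A"
  shows "U = {}"
proof -
  obtain F :: "nat \<Rightarrow> 'a set" where F: "\<And>n. closed (F n) \<and> interior (F n) = {}" "A \<subseteq> (\<Union>n. F n)"
    using assms unfolding meager_def by blast
  have "Met_TC.mtopology interior_of (\<Union>(range F)) = {}"
  proof (rule Met_TC.metric_Baire_category_alt)
    show "Met_TC.mcomplete TYPE('a)" by (simp add: complete_UNIV)
  qed (use F in auto)
  then have "interior (\<Union>(range F)) = {}" by simp
  moreover have "U \<subseteq> interior (\<Union>(range F))"
    using assms F(2) by (intro interior_maximal) auto
  ultimately show ?thesis by simp
qed

text \<open>
  Two points of a Banach space can be moved by one common small vector so that both leave prescribed
  meager sets. It transfers generic bounds to pairs of points with a fixed difference.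
\<close>

lemma avoid_meager_translates:
  fixes A B :: "'a::banach set"
  assumes A: "meager A" and B: "meager B" and "0 < r"
  obtains h where "norm h < r" "a + h \<notin> A" "b + h \<notin> B"
proof -
  have "meager ((+) (- a) ` A \<union> (+) (- b) ` B)"
    by (intro meager_Un meager_translation A B)
  from baire_category_open[OF this, of "ball 0 r"] \<open>0 < r\<close>
  have "\<not> ball 0 r \<subseteq> (+) (- a) ` A \<union> (+) (- b) ` B" by (metis ball_eq_empty not_less open_ball)
  then obtain h where "h \<in> ball 0 r" and h: "h \<notin> (+) (- a) ` A \<union> (+) (- b) ` B" by blast
  moreover have "a + h \<notin> A" "b + h \<notin> B"
    using h imageI[of "a + h" A "(+) (- a)"] imageI[of "b + h" B "(+) (- b)"] by auto
  ultimately show thesis using that[of h] by simp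
qed

text \<open>
  The sets that are open up to a meager set form a \<open>\<sigma>\<close>-algebra. For complements the open set is replaced
  by the interior of its complement, the difference being a nowhere dense boundary.
\<close>

lemma borel_Baire_property:
  fixes A :: "'a::topological_space set"
  assumes "A \<in> sets borel"
  shows "\<exists>G. open G \<and> meager (A - G) \<and> meager (G - A)"
proof -
  have "A \<in> sigma_sets UNIV {S. open S}" using assms by (simp add: borel_def)
  then show ?thesis
  proof (induction rule: sigma_sets.induct)
    case (Basic a)
    moreover have "meager {}" by (rule meager_nowhere_dense) auto
    ultimately show ?case by (intro exI[of _ a]) auto
  next
    case Empty
    have "meager {}" by (rule meager_nowhere_dense) auto
    then show ?case by (intro exI[of _ "{}"]) auto
  next
    case (Compl a)
    then obtain G where G: "open G" "meager (a - G)" "meager (G - a)" by blast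
    define H where "H = interior (- G)"
    have "interior (- G - H) = {}"
      unfolding H_def using interior_mono[of "- G - interior (- G)" "- G"]
        interior_subset[of "- G - interior (- G)"] by blast
    moreover have "closed (- G - H)"
      using G(1) by (auto simp: H_def closed_Diff open_interior)
    ultimately have "meager (- G - H)" by (simp add: meager_nowhere_dense)
    with G have "meager ((G - a) \<union> (- G - H))" by (simp add: meager_Un)
    then have "meager (UNIV - a - H)" by (rule meager_subset) auto
    moreover have "meager (H - (UNIV - a))"
      by (rule meager_subset[OF G(2)]) (use interior_subset[of "- G"] in \<open>auto simp: H_def\<close>)
    ultimately show ?case by (intro exI[of _ H]) (auto simp: H_def)
  next
    case (Union a)
    then obtain G where G: "\<And>i. open (G i)" "\<And>i. meager (a i - G i)" "\<And>i. meager (G i - a i)"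
      by metis
    have "meager (\<Union>i. a i - G i)" "meager (\<Union>i. G i - a i)"
      using G by (auto intro: meager_UN)
    then have "meager ((\<Union>i. a i) - (\<Union>i. G i))" "meager ((\<Union>i. G i) - (\<Union>i. a i))"
      by (blast intro: meager_subset)+
    then show ?case using G(1) by (intro exI[of _ "\<Union>i. G i"]) auto
  qed
qed

text \<open>
  The sublevel sets of the modulus exhaust the space, so one of them is nonmeager in \<open>W\<close>; by the Baire
  property it then fills a ball up to a meager set.
\<close>

lemma borel_generically_bounded:
  fixes g :: "'a::banach \<Rightarrow> real"
  assumes g: "g \<in> borel_measurable borel" and "open W" "W \<noteq> {}"
  obtains y r m where "0 < r" "ball y r \<subseteq> W" "meager {z \<in> ball y r. m < \<bar>g z\<bar>}"
proof -
  define A where "A = (\<lambda>n::nat. {z. \<bar>g z\<bar> \<le> real n})"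
  have "A n \<in> sets borel" for n
    using borel_measurable_le[of "\<lambda>z. \<bar>g z\<bar>" borel "\<lambda>_. real n"] g by (simp add: A_def)
  then have "\<forall>n. \<exists>G. open G \<and> meager (A n - G) \<and> meager (G - A n)"
    by (intro allI borel_Baire_property)
  then obtain G where G: "\<And>n. open (G n)" "\<And>n. meager (A n - G n)" "\<And>n. meager (G n - A n)"
    by metis
  have "\<exists>n. G n \<inter> W \<noteq> {}"
  proof (rule ccontr)
    assume "\<nexists>n. G n \<inter> W \<noteq> {}"
    then have disj: "z \<notin> G n" if "z \<in> W" for z n using that by blast
    have "W \<subseteq> (\<Union>n. A n - G n)"
    proof
      fix z assume "z \<in> W"
      obtain n where "z \<in> A n"
        using real_arch_simple[of "\<bar>g z\<bar>"] by (auto simp: A_def)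
      with disj[OF \<open>z \<in> W\<close>, of n] show "z \<in> (\<Union>n. A n - G n)" by blast
    qed
    moreover have "meager (\<Union>n. A n - G n)" using G(2) by (rule meager_UN)
    ultimately show False using baire_category_open[OF _ \<open>open W\<close>] \<open>W \<noteq> {}\<close> by simp
  qed
  then obtain n y where "y \<in> G n \<inter> W" by blast
  moreover have "open (G n \<inter> W)" using G(1) \<open>open W\<close> by blast
  ultimately obtain r where r: "0 < r" "ball y r \<subseteq> G n \<inter> W"
    using open_contains_ball by meson
  then have "meager {z \<in> ball y r. real n < \<bar>g z\<bar>}"
    by (intro meager_subset[OF G(3)[of n]]) (auto simp: A_def)
  with r show thesis using that by blast
qed

section \<open>Slope bounds and the Clarke subdifferential\<close>

text \<open>
  The number \<open>s\<close> bounds all short difference quotients of \<open>g\<close> in direction \<open>v\<close> near \<open>z\<close>. Clarke's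
  derivative of \<open>g\<close> at \<open>z\<close> in direction \<open>v\<close> is the infimum of these \<open>s\<close>. The relation replaces
  extended real arithmetic: it is a convex cone in \<open>(v, s)\<close>, also where the derivative is infinite.
\<close>

definition slope_bound :: "('e::real_normed_vector \<Rightarrow> real) \<Rightarrow> 'e \<Rightarrow> 'e \<Rightarrow> real \<Rightarrow> bool" where
  "slope_bound g z v s \<longleftrightarrow>
     (\<exists>d>0. \<forall>y\<in>ball z d. \<forall>t\<in>{0<..<d}. g (y + t *\<^sub>R v) - g y \<le> s * t)"

lemma slope_bound_mono: "slope_bound g z v s \<Longrightarrow> s \<le> s' \<Longrightarrow> slope_bound g z v s'"
  unfolding slope_bound_def by (meson greaterThanLessThan_iff less_imp_le mult_right_mono order_trans)

lemma slope_bound_zero_iff: "slope_bound g z 0 s \<longleftrightarrow> 0 \<le> s"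
proof
  assume "slope_bound g z 0 s"
  then obtain d where "0 < d" "\<And>y t. y \<in> ball z d \<Longrightarrow> t \<in> {0<..<d} \<Longrightarrow> g (y + t *\<^sub>R 0) - g y \<le> s * t"
    unfolding slope_bound_def by blast
  from this(2)[of z "d / 2"] \<open>0 < d\<close> show "0 \<le> s" by (simp add: zero_le_mult_iff)
qed (auto simp: slope_bound_def intro!: exI[of _ 1])

lemma slope_bound_add:
  assumes "slope_bound g z v s" "slope_bound g z w t"
  shows "slope_bound g z (v + w) (s + t)"
proof -
  obtain d where d: "0 < d" "\<And>y h. y \<in> ball z d \<Longrightarrow> h \<in> {0<..<d} \<Longrightarrow> g (y + h *\<^sub>R v) - g y \<le> s * h"
    using assms(1) unfolding slope_bound_def by blast
  obtain e where e: "0 < e" "\<And>y h. y \<in> ball z e \<Longrightarrow> h \<in> {0<..<e} \<Longrightarrow> g (y + h *\<^sub>R w) - g y \<le> t * h"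
    using assms(2) unfolding slope_bound_def by blast
  define r where "r = min d e / (1 + norm v)"
  have n1: "0 < 1 + norm v" by (simp add: add_pos_nonneg)
  then have r: "0 < r" "r * (1 + norm v) = min d e"
    using d e by (simp_all add: r_def)
  then have "r + r * norm v \<le> d" "r + r * norm v \<le> e" by (simp_all add: algebra_simps)
  moreover have "0 \<le> r * norm v" using r(1) by simp
  ultimately have rr: "r \<le> d" "r \<le> e" "r + r * norm v \<le> e" by linarith+
  have "g (y + h *\<^sub>R (v + w)) - g y \<le> (s + t) * h" if y: "y \<in> ball z r" and h: "h \<in> {0<..<r}" for y h
  proof -
    have "dist z (y + h *\<^sub>R v) \<le> dist z y + norm (h *\<^sub>R v)"
      using dist_triangle[of z "y + h *\<^sub>R v" y] by (simp add: dist_norm)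
    also have "\<dots> < r + r * norm v"
      using y h by (intro add_less_le_mono) (auto intro: mult_right_mono)
    also have "\<dots> \<le> e" by (rule rr)
    finally have "g ((y + h *\<^sub>R v) + h *\<^sub>R w) - g (y + h *\<^sub>R v) \<le> t * h"
      using h rr by (intro e) auto
    moreover have "g (y + h *\<^sub>R v) - g y \<le> s * h"
      using y h rr by (intro d) auto
    ultimately show ?thesis by (simp add: algebra_simps)
  qed
  with r(1) show ?thesis unfolding slope_bound_def by blast
qed

lemma slope_bound_scale:
  assumes "slope_bound g z v s" "0 < c"
  shows "slope_bound g z (c *\<^sub>R v) (c * s)"
proof -
  obtain d where d: "0 < d" "\<And>y h. y \<in> ball z d \<Longrightarrow> h \<in> {0<..<d} \<Longrightarrow> g (y + h *\<^sub>R v) - g y \<le> s * h"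
    using assms(1) unfolding slope_bound_def by blast
  have "g (y + h *\<^sub>R (c *\<^sub>R v)) - g y \<le> (c * s) * h"
    if "y \<in> ball z (min d (d / c))" "h \<in> {0<..<min d (d / c)}" for y h
    using d(2)[of y "h * c"] that \<open>0 < c\<close> by (simp add: field_simps)
  then show ?thesis
    unfolding slope_bound_def using d(1) \<open>0 < c\<close> by (intro exI[of _ "min d (d / c)"]) auto
qed

text \<open>
  Clarke's derivative is upper semicontinuous in the base point.
\<close>

lemma slope_bound_nearby:
  assumes "slope_bound g z v s"
  obtains r where "0 < r" "\<And>y. y \<in> ball z r \<Longrightarrow> slope_bound g y v s"
proof -
  obtain d where d: "0 < d" "\<And>y h. y \<in> ball z d \<Longrightarrow> h \<in> {0<..<d} \<Longrightarrow> g (y + h *\<^sub>R v) - g y \<le> s * h"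
    using assms(1) unfolding slope_bound_def by blast
  have "slope_bound g y v s" if y: "y \<in> ball z (d / 2)" for y
  proof -
    have "ball y (d / 2) \<subseteq> ball z d"
      using y by (smt (verit) dist_triangle field_sum_of_halves mem_ball subsetI)
    then show ?thesis
      unfolding slope_bound_def using d by (intro exI[of _ "d / 2"]) (auto simp: subset_iff)
  qed
  with d(1) show thesis using that[of "d / 2"] by simp
qed

lemma slope_bound_iff_eventually:
  "slope_bound g z v s \<longleftrightarrow>
     eventually (\<lambda>(y, t). (g (y + t *\<^sub>R v) - g y) / t \<le> s) (nhds z \<times>\<^sub>F at_right 0)"
proof
  assume "slope_bound g z v s"
  then obtain d where d: "0 < d" "\<And>y h. y \<in> ball z d \<Longrightarrow> h \<in> {0<..<d} \<Longrightarrow> g (y + h *\<^sub>R v) - g y \<le> s * h"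
    unfolding slope_bound_def by blast
  have "eventually (\<lambda>y. y \<in> ball z d) (nhds z)"
    using d(1) by (intro eventually_nhds_in_open) auto
  moreover have "eventually (\<lambda>t. t \<in> {0<..<d}) (at_right 0)"
    using d(1) by (intro eventually_at_right_real)
  ultimately show "eventually (\<lambda>(y, t). (g (y + t *\<^sub>R v) - g y) / t \<le> s) (nhds z \<times>\<^sub>F at_right 0)"
    unfolding eventually_prod_filter using d(2) by (fastforce simp: divide_le_eq)
next
  assume "eventually (\<lambda>(y, t). (g (y + t *\<^sub>R v) - g y) / t \<le> s) (nhds z \<times>\<^sub>F at_right 0)"
  then obtain P Q where P: "eventually P (nhds z)" and Q: "eventually Q (at_right 0)"
    and PQ: "\<And>y t. P y \<Longrightarrow> Q t \<Longrightarrow> (g (y + t *\<^sub>R v) - g y) / t \<le> s"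
    unfolding eventually_prod_filter by auto
  obtain d where d: "0 < d" "\<And>y. dist y z < d \<Longrightarrow> P y"
    using P unfolding eventually_nhds_metric by blast
  obtain b where b: "0 < b" "\<And>t. 0 < t \<Longrightarrow> t < b \<Longrightarrow> Q t"
    using Q unfolding eventually_at_right_field by blast
  have "g (y + t *\<^sub>R v) - g y \<le> s * t" if "y \<in> ball z (min d b)" "t \<in> {0<..<min d b}" for y t
    using PQ[of y t] d(2)[of y] b(2)[of t] that by (auto simp: divide_le_eq dist_commute)
  then show "slope_bound g z v s"
    unfolding slope_bound_def using d(1) b(1) by (intro exI[of _ "min d b"]) auto
qed

lemma clarke_subdiff_iff_slope_bound:
  "x' \<in> clarke_subdiff g z \<longleftrightarrow> (\<forall>v s. slope_bound g z v s \<longrightarrow> blinfun_apply x' v \<le> s)"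
proof (intro iffI allI impI)
  fix v s assume x': "x' \<in> clarke_subdiff g z" and "slope_bound g z v s"
  then have "clarke_derivative g z v \<le> ereal s"
    unfolding clarke_derivative_def slope_bound_iff_eventually
    by (intro Limsup_bounded) (auto elim: eventually_mono)
  with x' have "ereal (blinfun_apply x' v) \<le> ereal s"
    unfolding clarke_subdiff_def using order_trans by blast
  then show "blinfun_apply x' v \<le> s" by simp
next
  assume *: "\<forall>v s. slope_bound g z v s \<longrightarrow> blinfun_apply x' v \<le> s"
  have "ereal (blinfun_apply x' v) \<le> clarke_derivative g z v" for v
  proof (rule ccontr)
    assume "\<not> ?thesis"
    then obtain r where r: "clarke_derivative g z v < ereal r" "ereal r < ereal (blinfun_apply x' v)"
      using ereal_dense2 by (metis not_le)
    from Limsup_lessD[OF r(1)[unfolded clarke_derivative_def]] have "slope_bound g z v r"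
      unfolding slope_bound_iff_eventually by (rule eventually_mono) auto
    with * r(2) show False by fastforce
  qed
  then show "x' \<in> clarke_subdiff g z" unfolding clarke_subdiff_def by blast
qed

text \<open>
  If Clarke's derivative is bounded below by \<open>- C \<parallel>v\<parallel>\<close>, its infimal convolution with \<open>C \<parallel>\<cdot>\<parallel>\<close> is finite,
  sublinear and bounded by \<open>C \<parallel>\<cdot>\<parallel>\<close>, so linear minorants are continuous and belong to the
  subdifferential. The minorant that is exact at \<open>u\<close> has the value of the convolution there; this value
  is nearly attained at some \<open>w\<close>, which need not be \<open>u\<close> itself, because Clarke's derivative
  of a function that is not locally Lipschitz may be infinite at \<open>u\<close>.
\<close>

lemma clarke_subdiff_support:
  fixes g :: "'e::real_normed_vector \<Rightarrow> real"
  assumes below: "\<And>v s. slope_bound g z v s \<Longrightarrow> - (C * norm v) \<le> s" and "0 \<le> C"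
  obtains x' where "x' \<in> clarke_subdiff g z"
    "\<And>\<epsilon>. 0 < \<epsilon> \<Longrightarrow> \<exists>w s. slope_bound g z w s \<and> s + C * norm (u - w) < blinfun_apply x' u + \<epsilon>"
proof -
  define A where "A = (\<lambda>v. {s + C * norm (v - w) | w s. slope_bound g z w s})"
  have AI: "s + C * norm (v - w) \<in> A v" if "slope_bound g z w s" for v w s
    using that unfolding A_def by blast
  have zero: "slope_bound g z 0 0" by (simp add: slope_bound_zero_iff)
  have lower: "- (C * norm v) \<le> a" if a: "a \<in> A v" for a v
  proof -
    obtain w s where "slope_bound g z w s" "a = s + C * norm (v - w)"
      using a unfolding A_def by blast
    moreover have "C * norm w \<le> C * (norm v + norm (v - w))"
      using norm_triangle_ineq4[of v "v - w"] \<open>0 \<le> C\<close> by (intro mult_left_mono) auto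
    ultimately show ?thesis using below[of w s] by (simp add: algebra_simps)
  qed
  then have bdd: "bdd_below (A v)" for v by (meson bdd_belowI)
  have "sublinear (\<lambda>v. Inf (A v))"
  proof (rule sublinear_Inf)
    show "A x \<noteq> {}" for x using AI zero by blast
    show "bdd_below (A x)" for x by (rule bdd)
    show "\<exists>c\<in>A (x + y). c \<le> a + b" if ab: "a \<in> A x" "b \<in> A y" for x y a b
    proof -
      obtain v s where v: "slope_bound g z v s" "a = s + C * norm (x - v)"
        using ab(1) unfolding A_def by blast
      obtain w t where w: "slope_bound g z w t" "b = t + C * norm (y - w)"
        using ab(2) unfolding A_def by blast
      have "C * norm ((x + y) - (v + w)) \<le> C * (norm (x - v) + norm (y - w))"
        using norm_triangle_ineq[of "x - v" "y - w"] \<open>0 \<le> C\<close>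
        by (intro mult_left_mono) (simp_all add: algebra_simps)
      then have "(s + t) + C * norm ((x + y) - (v + w)) \<le> a + b"
        using v w by (simp add: algebra_simps)
      with AI[OF slope_bound_add[OF v(1) w(1)], of "x + y"] show ?thesis by blast
    qed
    show "\<exists>c\<in>A (t *\<^sub>R x). c \<le> t * a" if "0 < t" and a: "a \<in> A x" for x t a
    proof -
      obtain v s where v: "slope_bound g z v s" "a = s + C * norm (x - v)"
        using a unfolding A_def by blast
      have "norm (t *\<^sub>R x - t *\<^sub>R v) = t * norm (x - v)"
        using \<open>0 < t\<close> by (simp flip: scaleR_diff_right)
      then have "t * s + C * norm (t *\<^sub>R x - t *\<^sub>R v) \<le> t * a"
        using v by (simp add: algebra_simps)
      with AI[OF slope_bound_scale[OF v(1) \<open>0 < t\<close>], of "t *\<^sub>R x"] show ?thesis by blast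
    qed
  qed
  then obtain l where l: "linear l" "\<And>v. l v \<le> Inf (A v)" "l u = Inf (A u)"
    using hahn_banach_sublinear by blast
  have le: "l v \<le> a" if "a \<in> A v" for a v
    using l(2) cInf_lower[OF that bdd] order_trans by blast
  have bound: "l v \<le> C * norm v" for v
    using le[OF AI[OF zero, of v]] by simp
  have "norm (l v) \<le> norm v * C" for v
    using bound[of v] bound[of "- v"] linear_neg[OF l(1), of v] by (simp add: abs_le_iff mult.commute)
  with l(1) have "bounded_linear l"
    by (intro bounded_linear_intro[of l C]) (auto simp: linear_add linear_scale)
  then have app: "blinfun_apply (Blinfun l) = l" by (rule bounded_linear_Blinfun_apply)
  show thesis
  proof
    show "Blinfun l \<in> clarke_subdiff g z"
      unfolding clarke_subdiff_iff_slope_bound app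
    proof (intro allI impI)
      fix v s assume "slope_bound g z v s"
      from le[OF AI[OF this, of v]] show "l v \<le> s" by simp
    qed
    fix \<epsilon> :: real assume "0 < \<epsilon>"
    then have "Inf (A u) < l u + \<epsilon>" using l(3) by simp
    then obtain a where "a \<in> A u" "a < l u + \<epsilon>"
      using cInf_lessD[of "A u"] AI zero by blast
    then show "\<exists>w s. slope_bound g z w s \<and> s + C * norm (u - w) < blinfun_apply (Blinfun l) u + \<epsilon>"
      unfolding app A_def by blast
  qed
qed

section \<open>Lower bounds from bounded Clarke subdifferentials\<close>

text \<open>
  A substitute for following a flow. Read \<open>R y t y'\<close> as: one may walk from \<open>y\<close> to \<open>y'\<close> at cost \<open>t\<close>, a
  distance being at most a constant times its cost. Each step
  of the chain has at least half of the largest cost available within the budget \<open>L\<close>. If every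
  sufficiently cheap step were possible near the limit point while budget is left, the steps could not tend to zero;
  hence the walk stops only when the budget is exhausted or at a point near which steps
  are obstructed.
\<close>

lemma greedy_chain:
  fixes R :: "'a::complete_space \<Rightarrow> real \<Rightarrow> 'a \<Rightarrow> bool"
  assumes refl: "\<forall>y. R y 0 y"
    and trans: "\<forall>y s y' t y''. R y s y' \<longrightarrow> R y' t y'' \<longrightarrow> R y (s + t) y''"
    and dist: "\<forall>y t y'. R y t y' \<longrightarrow> dist y y' \<le> c * t"
    and "0 \<le> L" "0 \<le> c"
  shows "\<exists>s z s0 z0. (\<forall>n. R x (s n) (z n) \<and> s n \<le> L) \<and> s \<longlonglongrightarrow> s0 \<and> z \<longlonglongrightarrow> z0 \<and>
    ((\<exists>r>0. \<forall>y\<in>ball z0 r. \<forall>t\<in>{0<..<r}. \<exists>y'. R y t y') \<longrightarrow> s0 = L)"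
proof -
  define P where "P = (\<lambda>n::nat. \<lambda>(y, s). R x s y \<and> s \<le> L)"
  define Q where "Q = (\<lambda>n::nat. \<lambda>(y, s) (y', s'). s \<le> s' \<and> R y (s' - s) y' \<and>
    (\<forall>t\<ge>0. s + t \<le> L \<longrightarrow> (\<exists>y''. R y t y'') \<longrightarrow> t \<le> 2 * (s' - s)))"
  have step: "\<exists>b. P (Suc n) b \<and> Q n a b" if "P n a" for a n
  proof -
    obtain y s where a: "a = (y, s)" by fastforce
    with that have y: "R x s y" "s \<le> L" by (auto simp: P_def)
    \<comment> \<open>The costs available from \<open>y\<close>; at least half of their supremum is spent.\<close>
    define T where "T = {t. 0 \<le> t \<and> s + t \<le> L \<and> (\<exists>y'. R y t y')}"
    have T0: "0 \<in> T" using refl y by (auto simp: T_def)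
    have bdd: "bdd_above T" by (rule bdd_aboveI[of _ "L - s"]) (auto simp: T_def)
    have "\<exists>t\<in>T. \<forall>t'\<in>T. t' \<le> 2 * t"
    proof (cases "Sup T \<le> 0")
      case True
      then have "t' \<le> 2 * 0" if "t' \<in> T" for t'
        using cSup_upper[OF that bdd] by simp
      with T0 show ?thesis by blast
    next
      case False
      then have "Sup T / 2 < Sup T" by simp
      then obtain t where "t \<in> T" "Sup T / 2 < t"
        using less_cSupE[of "Sup T / 2" T] T0 by blast
      then have "t' \<le> 2 * t" if "t' \<in> T" for t'
        using cSup_upper[OF that bdd] by simp
      with \<open>t \<in> T\<close> show ?thesis by blast
    qed
    then obtain t y' where t: "0 \<le> t" "s + t \<le> L" "R y t y'" "\<And>t'. t' \<in> T \<Longrightarrow> t' \<le> 2 * t"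
      by (auto simp: T_def)
    have "P (Suc n) (y', s + t)" using trans[rule_format, OF y(1) t(3)] t(2) by (simp add: P_def)
    moreover have "Q n a (y', s + t)"
      unfolding Q_def a using t by (auto simp: T_def)
    ultimately show ?thesis by blast
  qed
  have "P 0 (x, 0)" using refl \<open>0 \<le> L\<close> by (simp add: P_def)
  then have "\<exists>w. P 0 w" ..
  from dependent_nat_choice[of P Q, OF this step]
  obtain w where w: "\<And>n. P n (w n)" "\<And>n. Q n (w n) (w (Suc n))" by blast
  define z where "z = (\<lambda>n. fst (w n))"
  define s where "s = (\<lambda>n. snd (w n))"
  have R: "R x (s n) (z n)" and sL: "s n \<le> L" for n
    using w(1)[of n] by (auto simp: P_def z_def s_def case_prod_beta)
  have mono: "s n \<le> s (Suc n)" and step: "R (z n) (s (Suc n) - s n) (z (Suc n))"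
    and greedy: "\<And>t. 0 \<le> t \<Longrightarrow> s n + t \<le> L \<Longrightarrow> \<exists>y. R (z n) t y \<Longrightarrow> t \<le> 2 * (s (Suc n) - s n)" for n
    using w(2)[of n] by (auto simp: Q_def z_def s_def case_prod_beta)
  have "incseq s" using mono by (rule incseq_SucI)
  then obtain s0 where s0: "s \<longlonglongrightarrow> s0" "\<And>n. s n \<le> s0"
    using incseq_convergent[of s L] sL by blast
  have far: "R (z m) (s (m + k) - s m) (z (m + k))" for m k
  proof (induction k)
    case 0
    then show ?case using refl by simp
  next
    case (Suc k)
    from trans[rule_format, OF this step[of "m + k"]] show ?case by simp
  qed
  have "Cauchy z"
    unfolding Cauchy_altdef
  proof (intro allI impI)
    fix e :: real assume "0 < e"
    then have "0 < e / (c + 1)" using \<open>0 \<le> c\<close> by simp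
    moreover have "Cauchy s" using s0(1) by (rule LIMSEQ_imp_Cauchy)
    ultimately obtain N where N: "\<And>m n. N \<le> m \<Longrightarrow> m < n \<Longrightarrow> dist (s m) (s n) < e / (c + 1)"
      unfolding Cauchy_altdef by blast
    have "dist (z m) (z n) < e" if "N \<le> m" "m < n" for m n
    proof -
      have "dist (z m) (z n) \<le> c * (s n - s m)"
        using dist[rule_format, OF far[of m "n - m"]] that by simp
      also have "\<dots> \<le> (c + 1) * (s n - s m)"
        using \<open>incseq s\<close> that by (intro mult_right_mono) (auto simp: incseq_def)
      also have "\<dots> < (c + 1) * (e / (c + 1))"
        using N[OF that] \<open>0 \<le> c\<close> by (intro mult_strict_left_mono) (auto simp: dist_real_def)
      also have "\<dots> = e" using \<open>0 \<le> c\<close> by simp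
      finally show ?thesis .
    qed
    then show "\<exists>N. \<forall>m\<ge>N. \<forall>n>m. dist (z m) (z n) < e" by blast
  qed
  then obtain z0 where z0: "z \<longlonglongrightarrow> z0" using Cauchy_convergent convergent_def by blast
  have "s0 = L" if good: "\<exists>r>0. \<forall>y\<in>ball z0 r. \<forall>t\<in>{0<..<r}. \<exists>y'. R y t y'"
  proof (rule ccontr)
    assume "s0 \<noteq> L"
    moreover have "s0 \<le> L" using s0(1) sL by (intro LIMSEQ_le_const2) auto
    ultimately have "s0 < L" by simp
    obtain r where r: "0 < r" "\<And>y t. y \<in> ball z0 r \<Longrightarrow> t \<in> {0<..<r} \<Longrightarrow> \<exists>y'. R y t y'"
      using good by blast
    define t where "t = min (r / 2) (L - s0)"
    have t: "0 < t" "t < r" "t \<le> L - s0"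
      using r \<open>s0 < L\<close> by (auto simp: t_def)
    have "eventually (\<lambda>n. z n \<in> ball z0 r) sequentially"
      using z0 r(1) by (auto dest: tendstoD simp: dist_commute)
    then have "eventually (\<lambda>n. t \<le> 2 * (s (Suc n) - s n)) sequentially"
    proof (rule eventually_mono)
      fix n assume "z n \<in> ball z0 r"
      with r(2)[of "z n" t] t s0(2)[of n] show "t \<le> 2 * (s (Suc n) - s n)"
        by (intro greedy) auto
    qed
    moreover have "(\<lambda>n. 2 * (s (Suc n) - s n)) \<longlonglongrightarrow> 2 * (s0 - s0)"
      by (intro tendsto_intros LIMSEQ_Suc s0)
    ultimately have "t \<le> 2 * (s0 - s0)"
      by (intro tendsto_lowerbound[where F = sequentially]) auto
    with t(1) show False by simp
  qed
  with R sL s0(1) z0 show ?thesis by blast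
qed

text \<open>
  Bounded Clarke subdifferentials may a priori be empty. Suppose that a slope falls
  below \<open>- K \<parallel>v\<parallel>\<close>. The same slope bound persists nearby and excludes all functionals of norm at most \<open>K\<close>, so the
  subdifferentials are empty on an open set. By \<open>clarke_subdiff_support\<close>, from each point of this set \<open>g\<close>
  then descends in some direction at any prescribed rate \<open>N\<close>, uniformly near that point. Finitely
  many such steps, chosen greedily, give a translation by a vector of norm at most \<open>r / 2\<close> along which \<open>g\<close> drops
  by at least \<open>N r / 4\<close> on a whole neighbourhood of the starting point. For large \<open>N\<close> this contradicts the boundedness of the Borel
  function \<open>g\<close> off a meager set. (For a discontinuous linear functional, which is not Borel,
  all Clarke subdifferentials are empty.)
\<close>

lemma clarke_bounded_imp_slope_ge:
  fixes g :: "'e::banach \<Rightarrow> real"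
  assumes g: "g \<in> borel_measurable borel" and "open U"
    and bound: "\<forall>y\<in>U. \<forall>x'\<in>clarke_subdiff g y. norm x' \<le> K"
    and "z \<in> U" "slope_bound g z v s"
  shows "- (K * norm v) \<le> s"
proof (rule ccontr)
  assume "\<not> ?thesis"
  then have s: "s < - (K * norm v)" by simp
  obtain r0 where r0: "0 < r0" "\<And>y. y \<in> ball z r0 \<Longrightarrow> slope_bound g y v s"
    using slope_bound_nearby[OF assms(5)] by blast
  define W where "W = ball z r0 \<inter> U"
  have W: "open W" "W \<noteq> {}" using r0(1) \<open>open U\<close> \<open>z \<in> U\<close> centre_in_ball[of z r0] unfolding W_def by blast+
  \<comment> \<open>A functional in the subdifferential would have a norm exceeding \<open>K\<close>.\<close>
  have empty: "clarke_subdiff g y = {}" if "y \<in> W" for y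
  proof (rule ccontr)
    assume "clarke_subdiff g y \<noteq> {}"
    then obtain x' where x': "x' \<in> clarke_subdiff g y" by blast
    have "blinfun_apply x' v \<le> s"
      using x' r0(2)[of y] that unfolding clarke_subdiff_iff_slope_bound W_def by blast
    moreover have "norm x' \<le> K" using bound x' that unfolding W_def by blast
    then have "\<bar>blinfun_apply x' v\<bar> \<le> K * norm v"
      using norm_blinfun[of x' v] mult_right_mono[of "norm x'" K "norm v"] by simp
    ultimately show False using s by linarith
  qed
  obtain x r m where r: "0 < r" "ball x r \<subseteq> W" and mea: "meager {y \<in> ball x r. m < \<bar>g y\<bar>}"
    by (rule borel_generically_bounded[OF g W]) (rule that)
  \<comment> \<open>The rate is such that a drop over a cost of \<open>r / 4\<close> exceeds the oscillation \<open>2 m\<close>.\<close>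
  define N where "N = 8 * \<bar>m\<bar> / r + 1"
  have N: "0 \<le> N" "2 * \<bar>m\<bar> < N * (r / 4)"
    using r(1) by (auto simp: N_def field_simps)
  define R where "R = (\<lambda>y t y'. 0 \<le> t \<and> dist y y' \<le> t \<and>
    (\<exists>d>0. \<forall>h. norm h < d \<longrightarrow> g (y' + h) \<le> g (y + h) - N * t))"
  have good: "\<exists>r>0. \<forall>y\<in>ball y0 r. \<forall>t\<in>{0<..<r}. \<exists>y'. R y t y'" if y0: "y0 \<in> ball x r" for y0
  proof -
    have "\<exists>v s. slope_bound g y0 v s \<and> s < - (N * norm v)"
    proof (rule ccontr)
      assume "\<not> ?thesis"
      then have "- (N * norm v) \<le> s" if "slope_bound g y0 v s" for v s
        using that by (meson not_less)
      then obtain x' where "x' \<in> clarke_subdiff g y0"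
        using clarke_subdiff_support[of g y0 N 0] N(1) by blast
      with empty[of y0] r(2) y0 show False by blast
    qed
    then obtain v s where v: "slope_bound g y0 v s" "s < - (N * norm v)" by blast
    then have "v \<noteq> 0" by (auto simp: slope_bound_zero_iff)
    define e where "e = (1 / norm v) *\<^sub>R v"
    have ne: "norm e = 1" using \<open>v \<noteq> 0\<close> by (simp add: e_def)
    have "slope_bound g y0 e (1 / norm v * s)"
      unfolding e_def using v(1) \<open>v \<noteq> 0\<close> by (intro slope_bound_scale) auto
    then have "slope_bound g y0 e (- N)"
      by (rule slope_bound_mono) (use v(2) \<open>v \<noteq> 0\<close> in \<open>simp add: field_simps\<close>)
    then obtain d where d: "0 < d"
        "\<And>y t. y \<in> ball y0 d \<Longrightarrow> t \<in> {0<..<d} \<Longrightarrow> g (y + t *\<^sub>R e) - g y \<le> - N * t"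
      unfolding slope_bound_def by blast
    have "R y t (y + t *\<^sub>R e)" if y: "y \<in> ball y0 (d / 2)" and t: "t \<in> {0<..<d / 2}" for y t
    proof -
      have "g (y + t *\<^sub>R e + h) \<le> g (y + h) - N * t" if h: "norm h < d / 2" for h
      proof -
        have "dist y0 (y + h) \<le> dist y0 y + norm h"
          using dist_triangle[of y0 "y + h" y] by (simp add: dist_norm)
        with y h have "y + h \<in> ball y0 d" by simp
        from d(2)[OF this, of t] t d(1) show ?thesis by (simp add: algebra_simps)
      qed
      then show ?thesis
        unfolding R_def using t ne d(1) by (auto simp: dist_norm intro!: exI[of _ "d / 2"])
    qed
    then show ?thesis using half_gt_zero[OF d(1)] by blast
  qed
  have refl: "\<forall>y. R y 0 y" by (auto simp: R_def intro: exI[of _ 1])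
  have trans: "\<forall>y s y' t y''. R y s y' \<longrightarrow> R y' t y'' \<longrightarrow> R y (s + t) y''"
  proof (intro allI impI)
    fix y s y' t y'' assume R: "R y s y'" "R y' t y''"
    obtain d where d: "0 < d" "\<And>h. norm h < d \<Longrightarrow> g (y' + h) \<le> g (y + h) - N * s"
      using R(1) unfolding R_def by blast
    obtain e where e: "0 < e" "\<And>h. norm h < e \<Longrightarrow> g (y'' + h) \<le> g (y' + h) - N * t"
      using R(2) unfolding R_def by blast
    have "g (y'' + h) \<le> g (y + h) - N * (s + t)" if "norm h < min d e" for h
      using d(2)[of h] e(2)[of h] that by (simp add: algebra_simps)
    moreover have "dist y y'' \<le> s + t"
      using R dist_triangle[of y y'' y'] by (simp add: R_def)
    ultimately show "R y (s + t) y''"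
      using R d(1) e(1) unfolding R_def by (intro conjI exI[of _ "min d e"]) auto
  qed
  have dist: "\<forall>y t y'. R y t y' \<longrightarrow> dist y y' \<le> 1 * t" by (simp add: R_def)
  have "0 \<le> r / 2" using r(1) by simp
  obtain t y t0 y0 where R: "\<forall>n. R x (t n) (y n) \<and> t n \<le> r / 2"
    and lim: "t \<longlonglongrightarrow> t0" "y \<longlonglongrightarrow> y0"
    and stop: "(\<exists>r>0. \<forall>y\<in>ball y0 r. \<forall>t\<in>{0<..<r}. \<exists>y'. R y t y') \<longrightarrow> t0 = r / 2"
    using greedy_chain[of R 1 "r / 2" x, OF refl trans dist \<open>0 \<le> r / 2\<close> zero_le_one]
    by (elim exE conjE) (rule that)
  have near: "dist x (y n) \<le> r / 2" for n
    using R[rule_format, of n] by (simp add: R_def)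
  moreover have "(\<lambda>n. dist x (y n)) \<longlonglongrightarrow> dist x y0" by (intro tendsto_intros lim)
  ultimately have "dist x y0 \<le> r / 2" by (intro LIMSEQ_le_const2) auto
  with r(1) good stop have "t0 = r / 2" by simp
  with lim(1) r(1) have "eventually (\<lambda>n. r / 4 < t n) sequentially"
    by (intro order_tendstoD(1)[of _ "r / 2"]) auto
  then obtain n where n: "r / 4 < t n" by (auto simp: eventually_sequentially)
  obtain d where d: "0 < d" "\<And>h. norm h < d \<Longrightarrow> g (y n + h) \<le> g (x + h) - N * t n"
    using R[rule_format, of n] unfolding R_def by blast
  obtain h where h: "norm h < min d (r / 2)" "x + h \<notin> {y \<in> ball x r. m < \<bar>g y\<bar>}"
      "y n + h \<notin> {y \<in> ball x r. m < \<bar>g y\<bar>}"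
    using avoid_meager_translates[OF mea mea, of "min d (r / 2)" x "y n"] d(1) r(1) by auto
  have "x + h \<in> ball x r" using h(1) r(1) by (simp add: dist_norm)
  moreover have "y n + h \<in> ball x r"
    using h(1) near[of n] dist_triangle[of x "y n + h" "y n"] by (simp add: dist_norm)
  ultimately have "\<bar>g (x + h)\<bar> \<le> m" "\<bar>g (y n + h)\<bar> \<le> m" using h by auto
  moreover have "g (y n + h) \<le> g (x + h) - N * t n" using d(2) h(1) by simp
  moreover have "N * (r / 4) \<le> N * t n" using n N(1) by (intro mult_left_mono) auto
  ultimately show False using N(2) by linarith
qed

text \<open>
  Since the derivative is bounded below by \<open>- K \<parallel>\<cdot>\<parallel>\<close>, its infimal convolution with \<open>C \<parallel>\<cdot>\<parallel>\<close> is at most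
  \<open>K\<close> on unit vectors for every \<open>C \<ge> K\<close>. A large \<open>C\<close> makes deviations from the direction \<open>u\<close>
  expensive, so the convolution is nearly attained at a direction close to \<open>u\<close>.
\<close>

lemma clarke_bounded_imp_slope_le:
  fixes g :: "'e::banach \<Rightarrow> real"
  assumes g: "g \<in> borel_measurable borel" and "open U"
    and bound: "\<forall>y\<in>U. \<forall>x'\<in>clarke_subdiff g y. norm x' \<le> K"
    and "z \<in> U" "0 \<le> K" "K < K'" "0 < \<epsilon>" "norm u = 1"
  obtains w where "norm (w - u) < \<epsilon>" "slope_bound g z w K'"
proof -
  \<comment> \<open>Chosen so that \<open>(C - K) \<epsilon>\<close> is the largest possible gain \<open>K' + K\<close>.\<close>
  define C where "C = K + (K' + K) / \<epsilon>"
  have C: "K \<le> C" "0 \<le> C" "(C - K) * \<epsilon> = K' + K" "0 < C - K" using assms by (auto simp: C_def)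
  have ge: "- (K * norm v) \<le> s" if "slope_bound g z v s" for v s
    using clarke_bounded_imp_slope_ge[OF g \<open>open U\<close> bound \<open>z \<in> U\<close> that] by blast
  have "- (C * norm v) \<le> s" if "slope_bound g z v s" for v s
    using ge[OF that] mult_right_mono[OF C(1), of "norm v"] by simp
  then obtain x' where x': "x' \<in> clarke_subdiff g z"
      "\<exists>w s. slope_bound g z w s \<and> s + C * norm (u - w) < blinfun_apply x' u + (K' - K)"
    using clarke_subdiff_support[of g z C u] C(2) \<open>K < K'\<close> by (metis diff_gt_0_iff_gt)
  have "blinfun_apply x' u \<le> K"
    using norm_blinfun[of x' u] bound \<open>z \<in> U\<close> x'(1) \<open>norm u = 1\<close> by fastforce
  with x'(2) obtain w s where w: "slope_bound g z w s" "s + C * norm (u - w) < K'" by force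
  have "0 \<le> C * norm (u - w)" using C by simp
  then have "s \<le> K'" using w by linarith
  have "norm w \<le> 1 + norm (u - w)"
    using norm_triangle_ineq4[of u "u - w"] \<open>norm u = 1\<close> by simp
  then have "K * norm w \<le> K * (1 + norm (u - w))" using \<open>0 \<le> K\<close> by (rule mult_left_mono)
  with ge[OF w(1)] w(2) have "(C - K) * norm (u - w) < (C - K) * \<epsilon>"
    unfolding C(3) by (simp add: algebra_simps)
  with C(4) have "norm (w - u) < \<epsilon>" by (simp add: norm_minus_commute)
  with slope_bound_mono[OF w(1) \<open>s \<le> K'\<close>] show thesis using that by blast
qed

text \<open>
  Walk from \<open>x\<close> towards \<open>x0\<close>: by the preceding lemma there is at each point a direction close to the
  one towards \<open>x0\<close> in which \<open>g\<close> increases at a rate of at most about \<open>K\<close>. The greedy walk can only stop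
  at \<open>x0\<close>, its length exceeds \<open>\<parallel>x - x0\<parallel>\<close> by an arbitrarily small amount, and lower semicontinuity at
  \<open>x0\<close> bounds \<open>g x0\<close> by the values along the walk.
  
  Semicontinuity at \<open>x0\<close> cannot be dropped: the negative of the indicator function of a dense proper
  Borel subspace has the subdifferential \<open>{0}\<close> at every point of the space, but it is not continuous.
\<close>

lemma clarke_bounded_imp_lower_bound:
  fixes g :: "'e::banach \<Rightarrow> real"
  assumes g: "g \<in> borel_measurable borel"
    and bound: "\<forall>y\<in>ball x0 r. \<forall>x'\<in>clarke_subdiff g y. norm x' \<le> K"
    and "0 \<le> K" and lsc: "\<And>c. c < g x0 \<Longrightarrow> eventually (\<lambda>y. c < g y) (nhds x0)"
    and x: "x \<in> ball x0 r"
  shows "g x0 - K * norm (x - x0) \<le> g x"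
proof -
  define D where "D = norm (x - x0)"
  have main: "g x0 \<le> g x + (K + \<kappa>) * (D / (1 - \<kappa>))" if \<kappa>: "0 < \<kappa>" "\<kappa> < 1" for \<kappa>
  proof -
    define R where "R = (\<lambda>y t y'. 0 \<le> t \<and> dist y y' \<le> 2 * t \<and> g y' \<le> g y + (K + \<kappa>) * t \<and>
      norm (y' - x0) \<le> norm (y - x0) - (1 - \<kappa>) * t)"
    have good: "\<exists>r>0. \<forall>y\<in>ball z r. \<forall>t\<in>{0<..<r}. \<exists>y'. R y t y'" if z: "z \<in> ball x0 r" "z \<noteq> x0" for z
    proof -
      define u where "u = (\<lambda>y. (1 / norm (x0 - y)) *\<^sub>R (x0 - y))"
      have "norm (u z) = 1" using z by (simp add: u_def)
      then obtain w where w: "norm (w - u z) < \<kappa> / 2" "slope_bound g z w (K + \<kappa>)"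
        using clarke_bounded_imp_slope_le[OF g open_ball bound z(1) \<open>0 \<le> K\<close>, of "K + \<kappa>" "\<kappa> / 2"] \<kappa>
        by auto
      obtain d where d: "0 < d"
          "\<And>y t. y \<in> ball z d \<Longrightarrow> t \<in> {0<..<d} \<Longrightarrow> g (y + t *\<^sub>R w) - g y \<le> (K + \<kappa>) * t"
        using w(2) unfolding slope_bound_def by blast
      have "isCont u z" unfolding u_def using z by (intro continuous_intros) auto
      then obtain e where e: "0 < e" "\<And>y. dist y z < e \<Longrightarrow> dist (u y) (u z) < \<kappa> / 2"
        using \<kappa> unfolding continuous_at_eps_delta by (meson half_gt_zero)
      define \<rho> where "\<rho> = min (min d e) (norm (z - x0) / 2)"
      have \<rho>: "0 < \<rho>" "\<rho> \<le> d" "\<rho> \<le> e" "\<rho> \<le> norm (z - x0) / 2"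
        using d(1) e(1) z by (auto simp: \<rho>_def)
      have "R y t (y + t *\<^sub>R w)" if y: "y \<in> ball z \<rho>" and t: "t \<in> {0<..<\<rho>}" for y t
      proof -
        have "norm w \<le> norm (u z) + norm (w - u z)" by (rule norm_triangle_sub)
        then have "norm w \<le> 2" using w(1) \<kappa> \<open>norm (u z) = 1\<close> by linarith
        then have "dist y (y + t *\<^sub>R w) \<le> 2 * t"
          using t by (simp add: dist_norm mult.commute)
        moreover have "g (y + t *\<^sub>R w) - g y \<le> (K + \<kappa>) * t"
          using y t \<rho> by (intro d(2)) auto
        moreover have "norm (y + t *\<^sub>R w - x0) \<le> norm (y - x0) - (1 - \<kappa>) * t"
        proof -
          have far: "t \<le> norm (x0 - y)" "y \<noteq> x0"
            using y t \<rho>(4) dist_triangle[of z x0 y] by (auto simp: dist_norm norm_minus_commute)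
          have "norm (w - u y) \<le> norm (w - u z) + norm (u z - u y)"
            using norm_triangle_ineq[of "w - u z" "u z - u y"] by simp
          also have "norm (u z - u y) < \<kappa> / 2"
            using e(2)[of y] y \<rho> by (simp add: dist_norm norm_minus_commute)
          finally have wu: "norm (w - u y) \<le> \<kappa>" using w(1) by simp
          have "y + t *\<^sub>R u y - x0 = (1 - t / norm (x0 - y)) *\<^sub>R (y - x0)"
            using far(2) by (simp add: u_def algebra_simps)
          then have "norm (y + t *\<^sub>R u y - x0) = \<bar>1 - t / norm (x0 - y)\<bar> * norm (x0 - y)"
            by (simp add: norm_minus_commute)
          also have "\<dots> = norm (y - x0) - t"
            using far by (simp add: abs_if field_simps norm_minus_commute)
          finally have "norm (y + t *\<^sub>R u y - x0) = norm (y - x0) - t" .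
          moreover have "norm (y + t *\<^sub>R w - x0) \<le> norm (y + t *\<^sub>R u y - x0) + norm (t *\<^sub>R (w - u y))"
            by (rule order_trans[OF _ norm_triangle_ineq]) (simp add: algebra_simps)
          moreover have "norm (t *\<^sub>R (w - u y)) \<le> t * \<kappa>"
            using wu t by (simp add: mult_left_mono)
          ultimately show ?thesis by (simp add: algebra_simps)
        qed
        ultimately show ?thesis using t by (simp add: R_def)
      qed
      with \<rho>(1) show ?thesis by blast
    qed
    \<comment> \<open>The cost of a walk towards \<open>x0\<close> is at most \<open>D / (1 - \<kappa>)\<close>, so this budget is never exhausted.\<close>
    define L where "L = D / (1 - \<kappa>) + 1"
    have "0 \<le> D" by (simp add: D_def)
    then have L: "0 \<le> L" using \<kappa> by (simp add: L_def)
    have refl: "\<forall>y. R y 0 y" by (simp add: R_def)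
    have trans: "\<forall>y s y' t y''. R y s y' \<longrightarrow> R y' t y'' \<longrightarrow> R y (s + t) y''"
    proof (intro allI impI)
      fix y s y' t y'' assume "R y s y'" "R y' t y''"
      then show "R y (s + t) y''"
        using dist_triangle[of y y'' y'] by (simp add: R_def algebra_simps)
    qed
    have dist: "\<forall>y t y'. R y t y' \<longrightarrow> dist y y' \<le> 2 * t" by (simp add: R_def)
    obtain t y t0 y0 where R: "\<forall>n. R x (t n) (y n) \<and> t n \<le> L"
      and lim: "t \<longlonglongrightarrow> t0" "y \<longlonglongrightarrow> y0"
      and stop: "(\<exists>r>0. \<forall>y\<in>ball y0 r. \<forall>t\<in>{0<..<r}. \<exists>y'. R y t y') \<longrightarrow> t0 = L"
      using greedy_chain[of R 2 L x, OF refl trans dist L zero_le_numeral] by (elim exE conjE) (rule that)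
    have t: "t n \<le> D / (1 - \<kappa>)" for n
    proof -
      have "0 \<le> D - (1 - \<kappa>) * t n"
        using R[rule_format, of n] norm_ge_zero[of "y n - x0"] unfolding R_def D_def by linarith
      then show ?thesis using \<kappa> by (simp add: field_simps)
    qed
    then have "t0 \<le> D / (1 - \<kappa>)" using lim(1) by (intro LIMSEQ_le_const2) auto
    then have "t0 \<noteq> L" by (simp add: L_def)
    moreover have "y0 \<in> ball x0 r"
    proof -
      have "norm (y n - x0) \<le> D" for n
      proof -
        have "0 \<le> (1 - \<kappa>) * t n" using R[rule_format, of n] \<kappa> by (simp add: R_def)
        with R[rule_format, of n] show ?thesis by (simp add: R_def D_def)
      qed
      moreover have "(\<lambda>n. norm (y n - x0)) \<longlonglongrightarrow> norm (y0 - x0)" by (intro tendsto_intros lim)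
      ultimately have "norm (y0 - x0) \<le> D" by (intro LIMSEQ_le_const2) auto
      with x show ?thesis by (simp add: D_def dist_norm norm_minus_commute)
    qed
    ultimately have "y0 = x0" using stop good by blast
    have "g (y n) \<le> g x + (K + \<kappa>) * (D / (1 - \<kappa>))" for n
    proof -
      have "g (y n) \<le> g x + (K + \<kappa>) * t n" using R[rule_format, of n] by (simp add: R_def)
      moreover have "(K + \<kappa>) * t n \<le> (K + \<kappa>) * (D / (1 - \<kappa>))"
        using t[of n] \<kappa> \<open>0 \<le> K\<close> by (intro mult_left_mono) auto
      ultimately show ?thesis by linarith
    qed
    moreover have "\<exists>n. c < g (y n)" if "c < g x0" for c
    proof -
      have "eventually (\<lambda>n. c < g (y n)) sequentially"
        using lsc[OF that] lim(2) unfolding \<open>y0 = x0\<close> by (rule eventually_compose_filterlim)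
      then show ?thesis by (auto simp: eventually_sequentially)
    qed
    ultimately show ?thesis by (meson dense_le less_le_trans order_less_imp_le)
  qed
  have "((\<lambda>\<kappa>. g x + (K + \<kappa>) * (D / (1 - \<kappa>))) \<longlongrightarrow> g x + (K + 0) * (D / (1 - 0))) (at_right 0)"
    by (intro tendsto_intros) auto
  moreover have "eventually (\<lambda>\<kappa>::real. g x0 \<le> g x + (K + \<kappa>) * (D / (1 - \<kappa>))) (at_right 0)"
    using eventually_at_right_real[of 0 1] by (rule eventually_mono) (use main in auto)
  ultimately have "g x0 \<le> g x + (K + 0) * (D / (1 - 0))"
    by (intro tendsto_lowerbound[where F = "at_right 0"]) auto
  then show ?thesis by (simp add: D_def)
qed

section \<open>Frechet subdifferentials and growth\<close>

lemma frechet_subdiff_nhds_lower_bound: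
  assumes "x' \<in> frechet_subdiff (\<lambda>e. ereal (g e)) x0" and "0 < \<epsilon>"
  shows "eventually (\<lambda>y. - (\<epsilon> * norm (y - x0)) \<le> g y - g x0 - blinfun_apply x' (y - x0)) (nhds x0)"
proof -
  have "ereal (- \<epsilon>) < 0" using \<open>0 < \<epsilon>\<close> by simp
  with assms(1) have "eventually (\<lambda>y. ereal (- \<epsilon>) < (ereal (g y) - ereal (g x0)
      - ereal (blinfun_apply x' (y - x0))) / ereal (norm (y - x0))) (at x0)"
    unfolding frechet_subdiff_def le_Liminf_iff by simp
  then have "eventually (\<lambda>y. y \<noteq> x0 \<longrightarrow>
      - (\<epsilon> * norm (y - x0)) \<le> g y - g x0 - blinfun_apply x' (y - x0)) (nhds x0)"
    unfolding eventually_at_filter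
    by (rule eventually_mono) (auto simp: less_divide_eq)
  then show ?thesis by (rule eventually_mono) auto
qed

text \<open>
  Through this property the local Frechet condition enters the bound at a distance from the base point.
\<close>

lemma frechet_subdiff_imp_lsc:
  assumes "x' \<in> frechet_subdiff (\<lambda>e. ereal (g e)) x0" and "c < g x0"
  shows "eventually (\<lambda>y. c < g y) (nhds x0)"
proof -
  have "((\<lambda>y. g x0 + blinfun_apply x' (y - x0) - norm (y - x0)) \<longlongrightarrow>
      g x0 + blinfun_apply x' (x0 - x0) - norm (x0 - x0)) (nhds x0)"
    by (intro tendsto_intros filterlim_ident)
  then have "eventually (\<lambda>y. c < g x0 + blinfun_apply x' (y - x0) - norm (y - x0)) (nhds x0)"
    by (rule order_tendstoD) (use assms(2) in simp)
  with frechet_subdiff_nhds_lower_bound[OF assms(1) zero_less_one] show ?thesis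
    by eventually_elim simp
qed

text \<open>
  On the ball with centre \<open>x0\<close> and twice the radius \<open>\<parallel>x - x0\<parallel>\<close> the growth condition gives a constant bound
  for the subdifferentials; the factor two puts \<open>x\<close> into the open ball.
\<close>

lemma clarke_growth_lower_bound:
  fixes g :: "'e::banach \<Rightarrow> real"
  assumes g: "g \<in> borel_measurable borel"
    and lsc: "\<And>c. c < g x0 \<Longrightarrow> eventually (\<lambda>y. c < g y) (nhds x0)"
    and bound: "\<forall>y. \<forall>x'\<in>clarke_subdiff g y. norm x' \<le> c * norm y powr s + \<alpha>"
    and "0 \<le> c" "0 \<le> s" "0 \<le> \<alpha>"
  shows "g x0 - (c * (norm x0 + 2 * norm (x - x0)) powr s + \<alpha>) * norm (x - x0) \<le> g x"
proof (cases "x = x0")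
  case False
  define r where "r = 2 * norm (x - x0)"
  have "\<forall>y\<in>ball x0 r. \<forall>x'\<in>clarke_subdiff g y. norm x' \<le> c * (norm x0 + r) powr s + \<alpha>"
  proof (intro ballI)
    fix y x' assume y: "y \<in> ball x0 r" and x': "x' \<in> clarke_subdiff g y"
    have "norm y \<le> norm x0 + r"
      using norm_triangle_sub[of y x0] y by (simp add: dist_norm norm_minus_commute)
    then have "c * norm y powr s \<le> c * (norm x0 + r) powr s"
      using \<open>0 \<le> c\<close> \<open>0 \<le> s\<close> by (intro mult_left_mono powr_mono2) auto
    with bound x' show "norm x' \<le> c * (norm x0 + r) powr s + \<alpha>" by fastforce
  qed
  moreover have "x \<in> ball x0 r" using False by (simp add: r_def dist_norm norm_minus_commute)
  moreover have "0 \<le> c * (norm x0 + r) powr s + \<alpha>" using assms by simp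
  ultimately show ?thesis
    using clarke_bounded_imp_lower_bound[OF g _ _ lsc] unfolding r_def by blast
qed simp

section \<open>Lebesgue spaces, the pairing and upper integrals\<close>

lemma powr_add_le:
  fixes a b p :: real
  assumes "0 \<le> a" "0 \<le> b" "0 \<le> p"
  shows "(a + b) powr p \<le> 2 powr p * (a powr p + b powr p)"
proof -
  have "(a + b) powr p \<le> (2 * max a b) powr p" using assms by (intro powr_mono2) auto
  also have "\<dots> = 2 powr p * max a b powr p" using assms by (simp add: powr_mult)
  also have "max a b powr p \<le> a powr p + b powr p" by (simp add: max_def)
  finally show ?thesis by simp
qed

lemma Lp_diff:
  assumes "x \<in> Lp M p" "y \<in> Lp M p" "0 \<le> p"
  shows "(\<lambda>\<omega>. x \<omega> - y \<omega>) \<in> Lp M p"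
proof -
  have [measurable]: "x \<in> borel_measurable M" "y \<in> borel_measurable M"
    using assms by (auto simp: Lp_def)
  have "integrable M (\<lambda>\<omega>. 2 powr p * (norm (x \<omega>) powr p + norm (y \<omega>) powr p))"
    using assms by (simp add: Lp_def)
  then have "integrable M (\<lambda>\<omega>. norm (x \<omega> - y \<omega>) powr p)"
  proof (rule Bochner_Integration.integrable_bound)
    have "norm (x \<omega> - y \<omega>) powr p \<le> (norm (x \<omega>) + norm (y \<omega>)) powr p" for \<omega>
      using \<open>0 \<le> p\<close> by (intro powr_mono2 norm_triangle_ineq4) auto
    then have "norm (x \<omega> - y \<omega>) powr p \<le> 2 powr p * (norm (x \<omega>) powr p + norm (y \<omega>) powr p)" for \<omega>
      using powr_add_le[of "norm (x \<omega>)" "norm (y \<omega>)" p] \<open>0 \<le> p\<close> by (meson norm_ge_zero order_trans)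
    then show "AE \<omega> in M. norm (norm (x \<omega> - y \<omega>) powr p)
        \<le> norm (2 powr p * (norm (x \<omega>) powr p + norm (y \<omega>) powr p))"
      by simp
  qed measurable
  then show ?thesis by (simp add: Lp_def)
qed

lemma
  fixes u v :: "'w \<Rightarrow> real"
  assumes "1 < p" "1 / p + 1 / q = 1"
    and meas [measurable]: "u \<in> borel_measurable M" "v \<in> borel_measurable M"
    and nonneg: "\<And>\<omega>. 0 \<le> u \<omega>" "\<And>\<omega>. 0 \<le> v \<omega>"
    and int: "integrable M (\<lambda>\<omega>. u \<omega> powr p)" "integrable M (\<lambda>\<omega>. v \<omega> powr q)"
  shows integrable_mult_conjugate: "integrable M (\<lambda>\<omega>. u \<omega> * v \<omega>)"
    and Holder_inequality: "(\<integral>\<omega>. u \<omega> * v \<omega> \<partial>M) \<le>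
      (\<integral>\<omega>. u \<omega> powr p \<partial>M) powr (1 / p) * (\<integral>\<omega>. v \<omega> powr q \<partial>M) powr (1 / q)"
proof -
  have "1 / q = 1 - 1 / p" using assms(2) by simp
  then have "0 < 1 / q" "1 / q < 1" using \<open>1 < p\<close> by auto
  then have q: "1 < q" by (simp add: divide_less_eq split: if_splits)
  have "integrable M (\<lambda>\<omega>. u \<omega> powr p / p + v \<omega> powr q / q)" using int by simp
  then show uv: "integrable M (\<lambda>\<omega>. u \<omega> * v \<omega>)"
  proof (rule Bochner_Integration.integrable_bound)
    have "u \<omega> * v \<omega> \<le> u \<omega> powr p / p + v \<omega> powr q / q" for \<omega>
      by (rule Youngs_inequality[OF assms(1) q assms(2) nonneg])
    then have "norm (u \<omega> * v \<omega>) \<le> norm (u \<omega> powr p / p + v \<omega> powr q / q)" for \<omega>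
      using nonneg[of \<omega>] by (smt (verit) mult_nonneg_nonneg real_norm_def)
    then show "AE \<omega> in M. norm (u \<omega> * v \<omega>) \<le> norm (u \<omega> powr p / p + v \<omega> powr q / q)"
      by simp
  qed measurable
  define A where "A = (\<integral>\<omega>. u \<omega> powr p \<partial>M) powr (1 / p)"
  define B where "B = (\<integral>\<omega>. v \<omega> powr q \<partial>M) powr (1 / q)"
  have AB: "0 \<le> A" "0 \<le> B" by (simp_all add: A_def B_def)
  have Ap: "A powr p = (\<integral>\<omega>. u \<omega> powr p \<partial>M)" and Bq: "B powr q = (\<integral>\<omega>. v \<omega> powr q \<partial>M)"
    using \<open>1 < p\<close> q by (simp_all add: A_def B_def powr_powr integral_nonneg_AE)
  have zero: "(\<integral>\<omega>. u \<omega> * v \<omega> \<partial>M) = 0" if "A = 0 \<or> B = 0"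
  proof -
    have "AE \<omega> in M. u \<omega> * v \<omega> = 0"
      using that
    proof
      assume "A = 0"
      then have "(\<integral>\<omega>. u \<omega> powr p \<partial>M) = 0" by (simp flip: Ap)
      then have "AE \<omega> in M. u \<omega> powr p = 0"
        using integral_nonneg_eq_0_iff_AE[OF int(1)] by simp
      then show ?thesis by (rule AE_mp) simp
    next
      assume "B = 0"
      then have "(\<integral>\<omega>. v \<omega> powr q \<partial>M) = 0" by (simp flip: Bq)
      then have "AE \<omega> in M. v \<omega> powr q = 0"
        using integral_nonneg_eq_0_iff_AE[OF int(2)] by simp
      then show ?thesis by (rule AE_mp) simp
    qed
    then show ?thesis by (rule integral_eq_zero_AE)
  qed
  have "(\<integral>\<omega>. u \<omega> * v \<omega> \<partial>M) \<le> A * B"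
  proof (cases "A = 0 \<or> B = 0")
    case True
    then show ?thesis using zero by auto
  next
    case False
    then have pos: "0 < A" "0 < B" using AB by auto
    have "u \<omega> * v \<omega> / (A * B) \<le> (u \<omega> powr p / A powr p) / p + (v \<omega> powr q / B powr q) / q" for \<omega>
      using Youngs_inequality[OF assms(1) q assms(2), of "u \<omega> / A" "v \<omega> / B"] nonneg pos
      by (simp add: powr_divide)
    then have "(\<integral>\<omega>. u \<omega> * v \<omega> / (A * B) \<partial>M)
        \<le> (\<integral>\<omega>. (u \<omega> powr p / A powr p) / p + (v \<omega> powr q / B powr q) / q \<partial>M)"
      using uv int by (intro integral_mono) auto
    also have "\<dots> = 1 / p + 1 / q"
      using int pos by (simp flip: Ap Bq)
    finally show ?thesis using pos assms(2) by (simp add: divide_le_eq)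
  qed
  then show "(\<integral>\<omega>. u \<omega> * v \<omega> \<partial>M) \<le>
      (\<integral>\<omega>. u \<omega> powr p \<partial>M) powr (1 / p) * (\<integral>\<omega>. v \<omega> powr q \<partial>M) powr (1 / q)"
    by (simp add: A_def B_def)
qed

text \<open>
  Scalar measurability suffices when the argument takes finitely many values, and measurable
  functions into a separable space are limits of such functions.
\<close>

lemma scalarly_measurable_pairing:
  fixes x' :: "'w \<Rightarrow> ('e::{banach, second_countable_topology} \<Rightarrow>\<^sub>L real)"
  assumes x': "\<And>e. (\<lambda>\<omega>. blinfun_apply (x' \<omega>) e) \<in> borel_measurable M"
    and x: "x \<in> borel_measurable M"
  shows "(\<lambda>\<omega>. blinfun_apply (x' \<omega>) (x \<omega>)) \<in> borel_measurable M"
proof -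
  obtain F where F: "\<forall>i. simple_function M (F i)" "\<forall>\<omega>\<in>space M. (\<lambda>i. F i \<omega>) \<longlonglongrightarrow> x \<omega>"
    using borel_measurable_implies_sequence_metric[OF x, of 0] by (elim exE conjE) (rule that)
  show ?thesis
  proof (rule borel_measurable_LIMSEQ_real)
    show "(\<lambda>i. blinfun_apply (x' \<omega>) (F i \<omega>)) \<longlonglongrightarrow> blinfun_apply (x' \<omega>) (x \<omega>)"
      if "\<omega> \<in> space M" for \<omega>
      by (intro tendsto_intros F(2)[rule_format] that)
    show "(\<lambda>\<omega>. blinfun_apply (x' \<omega>) (F i \<omega>)) \<in> borel_measurable M" for i
    proof (rule measurable_compose_countable'[where I = "F i ` space M"])
      show "F i \<in> measurable M (count_space (F i ` space M))"
        using F(1)[rule_format, of i] by (auto simp: simple_function_def measurable_count_space_eq2)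
      show "countable (F i ` space M)"
        using F(1)[rule_format, of i] by (simp add: simple_function_def countable_finite)
    qed (rule x')
  qed
qed

lemma Lq_pairing_integrable:
  assumes "1 < p" "1 / p + 1 / q = 1" and x': "x' \<in> Lq_weak_star M q" and x: "x \<in> Lp M p"
  shows "integrable M (\<lambda>\<omega>. blinfun_apply (x' \<omega>) (x \<omega>))"
    and "\<bar>Lq_pairing M x' x\<bar> \<le> (\<integral>\<omega>. norm (x' \<omega>) powr q \<partial>M) powr (1 / q) * Lp_norm M p x"
proof -
  have x_meas [measurable]: "x \<in> borel_measurable M"
    and [measurable]: "(\<lambda>\<omega>. norm (x' \<omega>)) \<in> borel_measurable M"
    using x x' by (simp_all add: Lp_def Lq_weak_star_def)
  have "(\<lambda>\<omega>. blinfun_apply (x' \<omega>) e) \<in> borel_measurable M" for e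
    using x' by (simp add: Lq_weak_star_def)
  from scalarly_measurable_pairing[OF this x_meas]
  have [measurable]: "(\<lambda>\<omega>. blinfun_apply (x' \<omega>) (x \<omega>)) \<in> borel_measurable M" .
  have int: "integrable M (\<lambda>\<omega>. norm (x \<omega>) powr p)" "integrable M (\<lambda>\<omega>. norm (x' \<omega>) powr q)"
    using x x' by (simp_all add: Lp_def Lq_weak_star_def)
  have prod: "integrable M (\<lambda>\<omega>. norm (x \<omega>) * norm (x' \<omega>))"
    by (rule integrable_mult_conjugate[OF assms(1,2) _ _ _ _ int]) auto
  have le: "norm (blinfun_apply (x' \<omega>) (x \<omega>)) \<le> norm (x \<omega>) * norm (x' \<omega>)" for \<omega>
    using norm_blinfun[of "x' \<omega>" "x \<omega>"] by (simp add: mult.commute)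
  show int': "integrable M (\<lambda>\<omega>. blinfun_apply (x' \<omega>) (x \<omega>))"
    by (rule Bochner_Integration.integrable_bound[OF prod]) (use le in auto)
  have "\<bar>Lq_pairing M x' x\<bar> \<le> (\<integral>\<omega>. norm (blinfun_apply (x' \<omega>) (x \<omega>)) \<partial>M)"
    unfolding Lq_pairing_def using integral_norm_bound by fastforce
  also have "\<dots> \<le> (\<integral>\<omega>. norm (x \<omega>) * norm (x' \<omega>) \<partial>M)"
    using int' prod le by (intro integral_mono) auto
  also have "\<dots> \<le> (\<integral>\<omega>. norm (x \<omega>) powr p \<partial>M) powr (1 / p) * (\<integral>\<omega>. norm (x' \<omega>) powr q \<partial>M) powr (1 / q)"
    by (rule Holder_inequality[OF assms(1,2) _ _ _ _ int]) auto
  finally show "\<bar>Lq_pairing M x' x\<bar> \<le> (\<integral>\<omega>. norm (x' \<omega>) powr q \<partial>M) powr (1 / q) * Lp_norm M p x"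
    by (simp add: Lp_norm_def mult.commute)
qed

lemma Lq_pairing_in_Lp_dual:
  assumes "1 < p" "1 / p + 1 / q = 1" and x': "x' \<in> Lq_weak_star M q"
  shows "Lq_pairing M x' \<in> Lp_dual M p"
  unfolding Lp_dual_def
proof (intro CollectI conjI ballI allI exI)
  note int = Lq_pairing_integrable[OF assms]
  fix x y :: "'a \<Rightarrow> 'b" and s :: real assume x: "x \<in> Lp M p"
  show "Lq_pairing M x' (\<lambda>\<omega>. s *\<^sub>R x \<omega>) = s * Lq_pairing M x' x"
    by (simp add: Lq_pairing_def blinfun.scaleR_right)
  show "\<bar>Lq_pairing M x' x\<bar> \<le> (\<integral>\<omega>. norm (x' \<omega>) powr q \<partial>M) powr (1 / q) * Lp_norm M p x"
    by (rule int(2)[OF x])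
  assume "y \<in> Lp M p"
  with x show "Lq_pairing M x' (\<lambda>\<omega>. x \<omega> + y \<omega>) = Lq_pairing M x' x + Lq_pairing M x' y"
    by (simp add: Lq_pairing_def blinfun.add_right int(1))
qed

text \<open>
  Subtracting \<open>k\<close> carries the integrable majorants of \<open>w\<close> to integrable majorants of \<open>v\<close>. This form avoids
  differences of upper integrals, which may be infinite.
\<close>

lemma upper_integral_add_le:
  assumes "AE \<omega> in M. v \<omega> + k \<omega> \<le> w \<omega>" and k: "integrable M k"
  shows "upper_integral M v + ereal (\<integral>\<omega>. k \<omega> \<partial>M) \<le> upper_integral M w"
  unfolding upper_integral_def[of M w]
proof (rule Inf_greatest, safe)
  fix u assume u: "integrable M u" "AE \<omega> in M. w \<omega> \<le> u \<omega>"
  have "AE \<omega> in M. v \<omega> \<le> u \<omega> - k \<omega>"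
    using assms(1) u(2) by eventually_elim linarith
  then have "upper_integral M v \<le> ereal (\<integral>\<omega>. u \<omega> - k \<omega> \<partial>M)"
    unfolding upper_integral_def using u(1) k
    by (intro Inf_lower CollectI exI[of _ "\<lambda>\<omega>. u \<omega> - k \<omega>"]) auto
  then have "upper_integral M v \<le> ereal (\<integral>\<omega>. u \<omega> \<partial>M) - ereal (\<integral>\<omega>. k \<omega> \<partial>M)"
    using u(1) k by simp
  then show "upper_integral M v + ereal (\<integral>\<omega>. k \<omega> \<partial>M) \<le> ereal (\<integral>\<omega>. u \<omega> \<partial>M)"
    by (cases "upper_integral M v") auto
qed

text \<open>
  As \<open>(p - 1) q = p\<close>, the growth bound has a \<open>q\<close>-th power that is integrable for \<open>A\<close>, \<open>d\<close> in \<open>L\<^sub>p\<close> and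
  \<open>\<alpha>\<close>, \<open>\<beta>\<close> in \<open>L\<^sub>q\<close>. The distance \<open>d\<close> is kept in a separate term, since it varies along a sequence while
  the other quantities are fixed.
\<close>

lemma growth_powr_conjugate_le:
  fixes A d \<alpha> \<beta> c p q :: real
  assumes "0 \<le> A" "0 \<le> d" "0 \<le> \<alpha>" "0 \<le> \<beta>" "0 \<le> c" "1 < p" "0 \<le> q" "(p - 1) * q = p"
  shows "(c * (A + 2 * d) powr (p - 1) + \<alpha> + \<beta>) powr q \<le>
    2 powr q * (2 powr q * (c powr q * (2 powr p * A powr p) + \<alpha> powr q) + \<beta> powr q) +
    (2 powr q * 2 powr q * c powr q * 2 powr p * 2 powr p) * d powr p"
proof -
  define B where "B = (A + 2 * d) powr (p - 1)"
  have B: "0 \<le> B" "B powr q = (A + 2 * d) powr p"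
    using assms by (simp_all add: B_def powr_powr)
  have Bp: "(A + 2 * d) powr p \<le> 2 powr p * (A powr p + 2 powr p * d powr p)"
    using powr_add_le[of A "2 * d" p] assms by (simp add: powr_mult)
  have "(c * B + \<alpha> + \<beta>) powr q \<le> 2 powr q * ((c * B + \<alpha>) powr q + \<beta> powr q)"
    using assms B by (intro powr_add_le) auto
  also have "\<dots> \<le> 2 powr q * (2 powr q * ((c * B) powr q + \<alpha> powr q) + \<beta> powr q)"
    using assms B by (intro mult_left_mono add_right_mono powr_add_le) auto
  also have "\<dots> = 2 powr q * (2 powr q * (c powr q * (A + 2 * d) powr p + \<alpha> powr q) + \<beta> powr q)"
    using assms B by (simp add: powr_mult)
  also have "\<dots> \<le> 2 powr q * (2 powr q * (c powr q * (2 powr p * (A powr p + 2 powr p * d powr p))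
      + \<alpha> powr q) + \<beta> powr q)"
    by (intro mult_left_mono add_right_mono Bp) auto
  finally show ?thesis by (simp add: B_def algebra_simps)
qed

text \<open>
  Along a subsequence \<open>d\<close>, and with it \<open>\<phi>\<close>, tends to zero almost everywhere. The majorant
  \<open>h + C d\<^sup>p\<close> depends on \<open>n\<close>; truncating \<open>\<phi>\<^sup>q - C d\<^sup>p\<close> at zero makes dominated convergence applicable
  with the fixed majorant \<open>h\<close>, and the part removed tends to zero in \<open>L\<^sub>1\<close>.
\<close>

lemma dominated_quotients_vanish_along_subsequence:
  fixes d \<phi> :: "nat \<Rightarrow> 'w \<Rightarrow> real"
  assumes "0 < p" "0 < q"
    and d: "\<And>n. integrable M (\<lambda>\<omega>. d n \<omega> powr p)" "\<And>n \<omega>. 0 \<le> d n \<omega>"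
      "(\<lambda>n. \<integral>\<omega>. d n \<omega> powr p \<partial>M) \<longlonglongrightarrow> 0"
    and \<phi>: "\<And>n. \<phi> n \<in> borel_measurable M" "\<And>n \<omega>. 0 \<le> \<phi> n \<omega>"
    and h: "integrable M h" "\<And>\<omega>. 0 \<le> h \<omega>" and "0 \<le> C"
    and bound: "\<And>n. AE \<omega> in M. \<phi> n \<omega> powr q \<le> h \<omega> + C * d n \<omega> powr p"
    and small: "AE \<omega> in M. \<forall>\<epsilon>>0. \<exists>\<delta>>0. \<forall>n. d n \<omega> < \<delta> \<longrightarrow> \<phi> n \<omega> \<le> \<epsilon>"
  shows "\<And>n. integrable M (\<lambda>\<omega>. \<phi> n \<omega> powr q)"
    and "\<exists>r. strict_mono r \<and> (\<lambda>n. \<integral>\<omega>. \<phi> (r n) \<omega> powr q \<partial>M) \<longlonglongrightarrow> 0"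
proof -
  have [measurable]: "\<phi> n \<in> borel_measurable M" for n by (rule \<phi>(1))
  have [measurable]: "(\<lambda>\<omega>. d n \<omega> powr p) \<in> borel_measurable M" "h \<in> borel_measurable M" for n
    using d(1) h(1) by auto
  show int: "integrable M (\<lambda>\<omega>. \<phi> n \<omega> powr q)" for n
  proof (rule Bochner_Integration.integrable_bound)
    show "integrable M (\<lambda>\<omega>. h \<omega> + C * d n \<omega> powr p)" using h(1) d(1) by simp
    show "AE \<omega> in M. norm (\<phi> n \<omega> powr q) \<le> norm (h \<omega> + C * d n \<omega> powr p)"
      using bound[of n] by eventually_elim simp
  qed measurable
  have "(\<lambda>n. \<integral>\<omega>. norm (d n \<omega> powr p) \<partial>M) \<longlonglongrightarrow> 0" using d(3) by simp
  from tendsto_L1_AE_subseq[of M "\<lambda>n \<omega>. d n \<omega> powr p", OF d(1) this]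
  obtain r :: "nat \<Rightarrow> nat" where r: "strict_mono r" and ae: "AE \<omega> in M. (\<lambda>n. d (r n) \<omega> powr p) \<longlonglongrightarrow> 0"
    by auto
  define \<psi> where "\<psi> = (\<lambda>n \<omega>. max 0 (\<phi> (r n) \<omega> powr q - C * d (r n) \<omega> powr p))"
  have [measurable]: "\<psi> n \<in> borel_measurable M" for n unfolding \<psi>_def by measurable
  have \<psi>_le: "AE \<omega> in M. norm (\<psi> n \<omega>) \<le> h \<omega>" for n
    using bound[of "r n"] by eventually_elim (use h(2) in \<open>simp add: \<psi>_def\<close>)
  have "AE \<omega> in M. (\<lambda>n. \<psi> n \<omega>) \<longlonglongrightarrow> 0"
    using ae small
  proof eventually_elim
    fix \<omega> assume lim: "(\<lambda>n. d (r n) \<omega> powr p) \<longlonglongrightarrow> 0"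
      and sm: "\<forall>\<epsilon>>0. \<exists>\<delta>>0. \<forall>n. d n \<omega> < \<delta> \<longrightarrow> \<phi> n \<omega> \<le> \<epsilon>"
    have "(\<lambda>n. \<phi> (r n) \<omega>) \<longlonglongrightarrow> 0"
    proof (rule tendstoI)
      fix e :: real assume "0 < e"
      then obtain \<delta> where \<delta>: "0 < \<delta>" "\<And>n. d n \<omega> < \<delta> \<Longrightarrow> \<phi> n \<omega> \<le> e / 2"
        using sm half_gt_zero by blast
      have "eventually (\<lambda>n. d (r n) \<omega> powr p < \<delta> powr p) sequentially"
        using lim by (rule order_tendstoD) (use \<delta> in simp)
      then show "eventually (\<lambda>n. dist (\<phi> (r n) \<omega>) 0 < e) sequentially"
      proof (rule eventually_mono)
        fix n assume *: "d (r n) \<omega> powr p < \<delta> powr p"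
        have "d (r n) \<omega> < \<delta>"
        proof (rule ccontr)
          assume "\<not> ?thesis"
          then have "\<delta> powr p \<le> d (r n) \<omega> powr p"
            using \<delta>(1) \<open>0 < p\<close> by (intro powr_mono2) auto
          with * show False by simp
        qed
        with \<delta>(2)[of "r n"] \<phi>(2)[of "r n" \<omega>] \<open>0 < e\<close> show "dist (\<phi> (r n) \<omega>) 0 < e" by simp
      qed
    qed
    then have "(\<lambda>n. \<phi> (r n) \<omega> powr q) \<longlonglongrightarrow> 0"
      using \<open>0 < q\<close> \<phi>(2) by (intro tendsto_zero_powrI[of _ _ "\<lambda>_. q" q]) auto
    then have "(\<lambda>n. max 0 (\<phi> (r n) \<omega> powr q - C * d (r n) \<omega> powr p)) \<longlonglongrightarrow> max 0 (0 - C * 0)"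
      by (intro tendsto_intros lim)
    then show "(\<lambda>n. \<psi> n \<omega>) \<longlonglongrightarrow> 0" by (simp add: \<psi>_def)
  qed
  then have \<psi>_lim: "(\<lambda>n. \<integral>\<omega>. \<psi> n \<omega> \<partial>M) \<longlonglongrightarrow> (\<integral>\<omega>. 0 \<partial>M)"
    by (intro integral_dominated_convergence[OF _ _ h(1)] \<psi>_le) auto
  have \<psi>_int: "integrable M (\<psi> n)" for n
  proof (rule Bochner_Integration.integrable_bound[OF h(1)])
    show "AE \<omega> in M. norm (\<psi> n \<omega>) \<le> norm (h \<omega>)"
      using \<psi>_le[of n] by eventually_elim simp
  qed measurable
  have le: "(\<integral>\<omega>. \<phi> (r n) \<omega> powr q \<partial>M) \<le> (\<integral>\<omega>. \<psi> n \<omega> \<partial>M) + C * (\<integral>\<omega>. d (r n) \<omega> powr p \<partial>M)" for n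
  proof -
    have "(\<integral>\<omega>. \<phi> (r n) \<omega> powr q \<partial>M) \<le> (\<integral>\<omega>. \<psi> n \<omega> + C * d (r n) \<omega> powr p \<partial>M)"
      using int d(1) \<psi>_int by (intro integral_mono) (auto simp: \<psi>_def)
    then show ?thesis using d(1) \<psi>_int by simp
  qed
  have lim: "(\<lambda>n. (\<integral>\<omega>. \<psi> n \<omega> \<partial>M) + C * (\<integral>\<omega>. d (r n) \<omega> powr p \<partial>M)) \<longlonglongrightarrow> 0"
    using tendsto_add[OF \<psi>_lim tendsto_mult_left[OF LIMSEQ_subseq_LIMSEQ[OF d(3) r], of C]]
    by (simp add: o_def)
  have "(\<lambda>n. \<integral>\<omega>. \<phi> (r n) \<omega> powr q \<partial>M) \<longlonglongrightarrow> 0"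
  proof (rule tendsto_sandwich[OF _ _ tendsto_const lim])
    show "eventually (\<lambda>n. 0 \<le> (\<integral>\<omega>. \<phi> (r n) \<omega> powr q \<partial>M)) sequentially" by simp
    show "eventually (\<lambda>n. (\<integral>\<omega>. \<phi> (r n) \<omega> powr q \<partial>M) \<le>
        (\<integral>\<omega>. \<psi> n \<omega> \<partial>M) + C * (\<integral>\<omega>. d (r n) \<omega> powr p \<partial>M)) sequentially"
      by (intro always_eventually allI le)
  qed
  with r show "\<exists>r. strict_mono r \<and> (\<lambda>n. \<integral>\<omega>. \<phi> (r n) \<omega> powr q \<partial>M) \<longlonglongrightarrow> 0" by blast
qed

lemma eventually_Lp_at:
  "eventually P (Lp_at M p x0) \<longleftrightarrow> (\<exists>r>0. \<forall>x\<in>Lp M p. 0 < Lp_norm M p (\<lambda>\<omega>. x \<omega> - x0 \<omega>) \<longrightarrow>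
     Lp_norm M p (\<lambda>\<omega>. x \<omega> - x0 \<omega>) < r \<longrightarrow> P x)"
  unfolding Lp_at_def
proof (subst eventually_INF_base)
  show "\<exists>t\<in>{0<..}. principal {x \<in> Lp M p. 0 < Lp_norm M p (\<lambda>\<omega>. x \<omega> - x0 \<omega>) \<and> Lp_norm M p (\<lambda>\<omega>. x \<omega> - x0 \<omega>) < t}
     \<le> inf (principal {x \<in> Lp M p. 0 < Lp_norm M p (\<lambda>\<omega>. x \<omega> - x0 \<omega>) \<and> Lp_norm M p (\<lambda>\<omega>. x \<omega> - x0 \<omega>) < r})
        (principal {x \<in> Lp M p. 0 < Lp_norm M p (\<lambda>\<omega>. x \<omega> - x0 \<omega>) \<and> Lp_norm M p (\<lambda>\<omega>. x \<omega> - x0 \<omega>) < s})"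
    if "r \<in> {0<..}" "s \<in> {0<..}" for r s
    using that by (intro bexI[of _ "min r s"]) auto
qed (auto simp: eventually_principal)

section \<open>The Frechet subdifferential of the integral functional\<close>

theorem corollary10p11:
  fixes M :: "'w measure"
    and f :: "'w \<Rightarrow> 'e::{banach, second_countable_topology} \<Rightarrow> real"
    and x0 :: "'w \<Rightarrow> 'e"
    and p q c :: real
    and a :: "'w \<Rightarrow> real"
  assumes "sigma_finite_measure M"
    and "complete_measure M"
    and "1 < p" and "1 / p + 1 / q = 1"
    and "(\<lambda>(\<omega>, e). f \<omega> e) \<in> borel_measurable (M \<Otimes>\<^sub>M borel)"
    and "x0 \<in> Lp M p"
    and "\<bar>integral_functional M f x0\<bar> \<noteq> \<infinity>"
    and "0 < c"
    and "a \<in> Lp M q" and "AE \<omega> in M. 0 \<le> a \<omega>"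
    and "AE \<omega> in M. \<forall>e. \<forall>e'\<in>clarke_subdiff (f \<omega>) e. norm e' \<le> c * norm e powr (p - 1) + a \<omega>"
  shows "Lq_pairing M ` Lq_selections M q (\<lambda>\<omega>. frechet_subdiff (\<lambda>e. ereal (f \<omega> e)) (x0 \<omega>))
           \<subseteq> Lp_frechet_subdiff M p (integral_functional M f) x0"
proof (rule image_subsetI)
  fix x' :: "'w \<Rightarrow> ('e \<Rightarrow>\<^sub>L real)"
  assume sel: "x' \<in> Lq_selections M q (\<lambda>\<omega>. frechet_subdiff (\<lambda>e. ereal (f \<omega> e)) (x0 \<omega>))"
  then have x': "x' \<in> Lq_weak_star M q"
    and fre: "AE \<omega> in M. x' \<omega> \<in> frechet_subdiff (\<lambda>e. ereal (f \<omega> e)) (x0 \<omega>)"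
    by (simp_all add: Lq_selections_def)
  have "1 / q = 1 - 1 / p" using assms(4) by simp
  then have "0 < 1 / q" "1 / q < 1" using \<open>1 < p\<close> by auto
  then have q: "1 < q" by (simp add: divide_less_eq split: if_splits)
  have pq: "(p - 1) * q = p" using assms(3,4) q by (simp add: field_simps)
  note f_meas = \<open>(\<lambda>(\<omega>, e). f \<omega> e) \<in> borel_measurable (M \<Otimes>\<^sub>M borel)\<close>
  have f_borel: "f \<omega> \<in> borel_measurable borel" if "\<omega> \<in> space M" for \<omega>
    using measurable_compose[OF measurable_Pair1'[OF that] f_meas] by simp
  have f_comp: "(\<lambda>\<omega>. f \<omega> (x \<omega>)) \<in> borel_measurable M" if "x \<in> borel_measurable M" for x
    using measurable_compose[OF measurable_Pair[OF measurable_ident that] f_meas] by simp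
  have x0_meas [measurable]: "x0 \<in> borel_measurable M"
    and x'_norm [measurable]: "(\<lambda>\<omega>. norm (x' \<omega>)) \<in> borel_measurable M"
    and a_meas [measurable]: "a \<in> borel_measurable M"
    using assms(6,9) x' by (simp_all add: Lp_def Lq_weak_star_def)
  have x'_sc: "(\<lambda>\<omega>. blinfun_apply (x' \<omega>) e) \<in> borel_measurable M" for e
    using x' by (simp add: Lq_weak_star_def)

  define d where "d = (\<lambda>x \<omega>. norm (x \<omega> - x0 \<omega>))"
  define rem where "rem = (\<lambda>x \<omega>. f \<omega> (x \<omega>) - f \<omega> (x0 \<omega>) - blinfun_apply (x' \<omega>) (x \<omega> - x0 \<omega>))"
  define \<phi> where "\<phi> = (\<lambda>x \<omega>. max 0 (- rem x \<omega>) / d x \<omega>)"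
  define h where "h = (\<lambda>\<omega>. 2 powr q * (2 powr q * (c powr q * (2 powr p * norm (x0 \<omega>) powr p)
    + norm (a \<omega>) powr q) + norm (x' \<omega>) powr q))"
  define C where "C = 2 powr q * 2 powr q * c powr q * 2 powr p * 2 powr p"
  have d_int: "integrable M (\<lambda>\<omega>. d x \<omega> powr p)" and diff: "(\<lambda>\<omega>. x \<omega> - x0 \<omega>) \<in> Lp M p"
    if "x \<in> Lp M p" for x
    using Lp_diff[OF that assms(6)] \<open>1 < p\<close> by (simp_all add: Lp_def d_def)
  have d_norm: "(\<integral>\<omega>. d x \<omega> powr p \<partial>M) powr (1 / p) = Lp_norm M p (\<lambda>\<omega>. x \<omega> - x0 \<omega>)" for x
    by (simp add: d_def Lp_norm_def)
  have \<phi>_nonneg: "0 \<le> \<phi> x \<omega>" and d_nonneg: "0 \<le> d x \<omega>" for x \<omega>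
    by (simp_all add: \<phi>_def d_def)
  \<comment> \<open>Also where \<open>d\<close> vanishes, and with it the remainder.\<close>
  have \<phi>_d: "\<phi> x \<omega> * d x \<omega> = max 0 (- rem x \<omega>)" for x \<omega>
    by (auto simp: \<phi>_def d_def rem_def)
  have \<phi>_meas: "\<phi> x \<in> borel_measurable M" if "x \<in> Lp M p" for x
  proof -
    have [measurable]: "x \<in> borel_measurable M" using that by (simp add: Lp_def)
    have [measurable]: "(\<lambda>\<omega>. blinfun_apply (x' \<omega>) (x \<omega> - x0 \<omega>)) \<in> borel_measurable M"
      by (rule scalarly_measurable_pairing[OF x'_sc]) measurable
    have [measurable]: "(\<lambda>\<omega>. f \<omega> (x \<omega>)) \<in> borel_measurable M" "(\<lambda>\<omega>. f \<omega> (x0 \<omega>)) \<in> borel_measurable M"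
      by (rule f_comp, measurable)+
    show ?thesis unfolding \<phi>_def rem_def d_def by measurable
  qed
  have h_int: "integrable M h"
    using assms(6,9) x' unfolding h_def by (simp add: Lp_def Lq_weak_star_def)
  have h_nonneg: "0 \<le> h \<omega>" for \<omega> by (simp add: h_def)
  have "0 \<le> C" by (simp add: C_def)

  have \<phi>_bound: "AE \<omega> in M. \<phi> x \<omega> powr q \<le> h \<omega> + C * d x \<omega> powr p" for x
    using AE_space fre assms(10,11)
  proof eventually_elim
    fix \<omega> assume \<omega>: "\<omega> \<in> space M" and F: "x' \<omega> \<in> frechet_subdiff (\<lambda>e. ereal (f \<omega> e)) (x0 \<omega>)"
      and a: "0 \<le> a \<omega>"
      and Cl: "\<forall>e. \<forall>e'\<in>clarke_subdiff (f \<omega>) e. norm e' \<le> c * norm e powr (p - 1) + a \<omega>"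
    define G where "G = c * (norm (x0 \<omega>) + 2 * d x \<omega>) powr (p - 1) + a \<omega>"
    have G: "0 \<le> G" using a \<open>0 < c\<close> by (simp add: G_def)
    have "f \<omega> (x0 \<omega>) - G * d x \<omega> \<le> f \<omega> (x \<omega>)"
      unfolding G_def d_def
      by (rule clarke_growth_lower_bound[OF f_borel[OF \<omega>] frechet_subdiff_imp_lsc[OF F] Cl])
         (use \<open>0 < c\<close> \<open>1 < p\<close> a in auto)
    moreover have "blinfun_apply (x' \<omega>) (x \<omega> - x0 \<omega>) \<le> norm (x' \<omega>) * d x \<omega>"
      using norm_blinfun[of "x' \<omega>" "x \<omega> - x0 \<omega>"] by (simp add: d_def)
    ultimately have "- rem x \<omega> \<le> (G + norm (x' \<omega>)) * d x \<omega>"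
      by (simp add: rem_def algebra_simps)
    then have "max 0 (- rem x \<omega>) \<le> (G + norm (x' \<omega>)) * d x \<omega>"
      using G d_nonneg[of x \<omega>] by simp
    then have "\<phi> x \<omega> \<le> G + norm (x' \<omega>)"
      using G d_nonneg[of x \<omega>] by (cases "d x \<omega> = 0") (simp_all add: \<phi>_def divide_le_eq)
    then have "\<phi> x \<omega> powr q \<le> (G + norm (x' \<omega>)) powr q"
      using \<phi>_nonneg q by (intro powr_mono2) auto
    also have "\<dots> \<le> h \<omega> + C * d x \<omega> powr p"
      using growth_powr_conjugate_le[of "norm (x0 \<omega>)" "d x \<omega>" "a \<omega>" "norm (x' \<omega>)" c p q]
        d_nonneg a \<open>0 < c\<close> \<open>1 < p\<close> q pq by (simp add: G_def h_def C_def)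
    finally show "\<phi> x \<omega> powr q \<le> h \<omega> + C * d x \<omega> powr p" .
  qed

  have \<phi>_small: "AE \<omega> in M. \<forall>\<epsilon>>0. \<exists>\<delta>>0. \<forall>x. d x \<omega> < \<delta> \<longrightarrow> \<phi> x \<omega> \<le> \<epsilon>"
    using fre
  proof eventually_elim
    fix \<omega> assume F: "x' \<omega> \<in> frechet_subdiff (\<lambda>e. ereal (f \<omega> e)) (x0 \<omega>)"
    show "\<forall>\<epsilon>>0. \<exists>\<delta>>0. \<forall>x. d x \<omega> < \<delta> \<longrightarrow> \<phi> x \<omega> \<le> \<epsilon>"
    proof (intro allI impI)
      fix \<epsilon> :: real assume "0 < \<epsilon>"
      from frechet_subdiff_nhds_lower_bound[OF F this] obtain \<delta> where \<delta>: "0 < \<delta>"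
        "\<forall>y. dist y (x0 \<omega>) < \<delta> \<longrightarrow> - (\<epsilon> * norm (y - x0 \<omega>))
           \<le> f \<omega> y - f \<omega> (x0 \<omega>) - blinfun_apply (x' \<omega>) (y - x0 \<omega>)"
        unfolding eventually_nhds_metric by (elim exE conjE) (rule that)
      have "\<phi> x \<omega> \<le> \<epsilon>" if "d x \<omega> < \<delta>" for x
      proof -
        have "- rem x \<omega> \<le> \<epsilon> * d x \<omega>"
          using \<delta>(2)[rule_format, of "x \<omega>"] that by (simp add: rem_def d_def dist_norm)
        then have "max 0 (- rem x \<omega>) \<le> \<epsilon> * d x \<omega>"
          using \<open>0 < \<epsilon>\<close> d_nonneg[of x \<omega>] by simp
        then show ?thesis
          using \<open>0 < \<epsilon>\<close> d_nonneg[of x \<omega>] by (cases "d x \<omega> = 0") (simp_all add: \<phi>_def divide_le_eq)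
      qed
      with \<delta>(1) show "\<exists>\<delta>>0. \<forall>x. d x \<omega> < \<delta> \<longrightarrow> \<phi> x \<omega> \<le> \<epsilon>" by blast
    qed
  qed

  define N where "N = (\<lambda>x. Lp_norm M p (\<lambda>\<omega>. x \<omega> - x0 \<omega>))"
  define J where "J = integral_functional M f"
  define l where "l = (\<lambda>x. Lq_pairing M x' (\<lambda>\<omega>. x \<omega> - x0 \<omega>))"
  \<comment> \<open>Small \<open>L\<^sub>q\<close>-norm of \<open>\<phi>\<close> bounds the quotient in the Frechet condition from below.\<close>
  have quotient: "ereal (- \<epsilon>) < (J x - J x0 - ereal (l x)) / ereal (N x)"
    if x: "x \<in> Lp M p" and N: "0 < N x" and int: "integrable M (\<lambda>\<omega>. \<phi> x \<omega> powr q)"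
      and less: "(\<integral>\<omega>. \<phi> x \<omega> powr q \<partial>M) < \<epsilon> powr q" and "0 < \<epsilon>" for x \<epsilon>
  proof -
    have [measurable]: "x \<in> borel_measurable M" using x by (simp add: Lp_def)
    have d_meas: "d x \<in> borel_measurable M" unfolding d_def by measurable
    note holder = d_meas \<phi>_meas[OF x] d_nonneg \<phi>_nonneg d_int[OF x] int
    define S where "S = (\<integral>\<omega>. d x \<omega> * \<phi> x \<omega> \<partial>M)"
    have prod: "integrable M (\<lambda>\<omega>. d x \<omega> * \<phi> x \<omega>)"
      by (rule integrable_mult_conjugate[OF assms(3,4) holder])
    have "(\<integral>\<omega>. \<phi> x \<omega> powr q \<partial>M) powr (1 / q) < (\<epsilon> powr q) powr (1 / q)"
      using less q by (intro powr_less_mono2) auto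
    then have root: "(\<integral>\<omega>. \<phi> x \<omega> powr q \<partial>M) powr (1 / q) < \<epsilon>"
      using q \<open>0 < \<epsilon>\<close> by (simp add: powr_powr)
    have "S \<le> N x * (\<integral>\<omega>. \<phi> x \<omega> powr q \<partial>M) powr (1 / q)"
      using Holder_inequality[OF assms(3,4) holder] by (simp add: S_def N_def d_norm)
    also have "\<dots> < N x * \<epsilon>" using root N by simp
    finally have S: "S < \<epsilon> * N x" by (simp add: mult.commute)
    \<comment> \<open>An integrable function that, added to \<open>f(\<cdot>, x0(\<cdot>))\<close>, stays below \<open>f(\<cdot>, x(\<cdot>))\<close>.\<close>
    define k where "k = (\<lambda>\<omega>. blinfun_apply (x' \<omega>) (x \<omega> - x0 \<omega>) - d x \<omega> * \<phi> x \<omega>)"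
    have k_int: "integrable M k" and k: "(\<integral>\<omega>. k \<omega> \<partial>M) = l x - S"
      using Lq_pairing_integrable(1)[OF assms(3,4) x' diff[OF x]] prod
      by (simp_all add: k_def l_def S_def Lq_pairing_def)
    have "f \<omega> (x0 \<omega>) + k \<omega> \<le> f \<omega> (x \<omega>)" for \<omega>
    proof -
      have "k \<omega> = blinfun_apply (x' \<omega>) (x \<omega> - x0 \<omega>) - max 0 (- rem x \<omega>)"
        using \<phi>_d[of x \<omega>] by (simp add: k_def mult.commute)
      then show ?thesis by (simp add: rem_def)
    qed
    then have le: "J x0 + ereal (l x - S) \<le> J x"
      using upper_integral_add_le[where M = M and v = "\<lambda>\<omega>. f \<omega> (x0 \<omega>)" and k = k and w = "\<lambda>\<omega>. f \<omega> (x \<omega>)"] k_int k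
      by (simp add: J_def integral_functional_def)
    obtain j where j: "J x0 = ereal j"
      using assms(7) unfolding J_def[symmetric] by (cases "J x0") auto
    show ?thesis
    proof (cases "J x")
      case (real i)
      then have "- (\<epsilon> * N x) < i - j - l x" using le j S by simp
      with N real j show ?thesis by (simp add: less_divide_eq)
    next
      case PInf
      then show ?thesis using N j by simp
    next
      case MInf
      then show ?thesis using le j by simp
    qed
  qed

  have "eventually (\<lambda>x. ereal (- \<epsilon>) < (J x - J x0 - ereal (l x)) / ereal (N x)) (Lp_at M p x0)"
    if "0 < \<epsilon>" for \<epsilon>
  proof (rule ccontr)
    \<comment> \<open>A sequence that tends to \<open>x0\<close> and violates the bound would have a member covered by \<open>quotient\<close>.\<close>
    assume neg: "\<not> ?thesis"
    have "\<exists>x. x \<in> Lp M p \<and> 0 < N x \<and> N x < inverse (real (Suc n)) \<and>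
        \<not> ereal (- \<epsilon>) < (J x - J x0 - ereal (l x)) / ereal (N x)" for n :: nat
    proof (rule ccontr)
      assume "\<not> ?thesis"
      then have "\<forall>x\<in>Lp M p. 0 < N x \<longrightarrow> N x < inverse (real (Suc n)) \<longrightarrow>
          ereal (- \<epsilon>) < (J x - J x0 - ereal (l x)) / ereal (N x)" by blast
      moreover have "0 < inverse (real (Suc n))" by simp
      ultimately have "\<exists>r>0. \<forall>x\<in>Lp M p. 0 < N x \<longrightarrow> N x < r \<longrightarrow>
          ereal (- \<epsilon>) < (J x - J x0 - ereal (l x)) / ereal (N x)" by blast
      with neg show False unfolding eventually_Lp_at N_def by (rule notE)
    qed
    then have "\<forall>n::nat. \<exists>x. x \<in> Lp M p \<and> 0 < N x \<and> N x < inverse (real (Suc n)) \<and>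
        \<not> ereal (- \<epsilon>) < (J x - J x0 - ereal (l x)) / ereal (N x)" by (rule allI)
    from choice[OF this] obtain X where X: "\<forall>n::nat. X n \<in> Lp M p \<and> 0 < N (X n) \<and> N (X n) < inverse (real (Suc n)) \<and>
        \<not> ereal (- \<epsilon>) < (J (X n) - J x0 - ereal (l (X n))) / ereal (N (X n))"
      by (elim exE) (rule that)
    have N0: "(\<lambda>n. N (X n)) \<longlonglongrightarrow> 0"
    proof (rule tendsto_sandwich[OF _ _ tendsto_const LIMSEQ_inverse_real_of_nat])
      show "eventually (\<lambda>n. 0 \<le> N (X n)) sequentially"
        using X by (intro always_eventually allI) (simp add: less_imp_le)
      show "eventually (\<lambda>n. N (X n) \<le> inverse (real (Suc n))) sequentially"
        using X by (intro always_eventually allI) (simp add: less_imp_le)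
    qed
    have "(\<integral>\<omega>. d x \<omega> powr p \<partial>M) = N x powr p" for x
      using \<open>1 < p\<close> by (simp add: N_def powr_powr integral_nonneg_AE flip: d_norm)
    moreover have "(\<lambda>n. N (X n) powr p) \<longlonglongrightarrow> 0"
      using X \<open>1 < p\<close>
      by (intro tendsto_zero_powrI[OF N0 tendsto_const] always_eventually allI) (auto simp: less_imp_le)
    ultimately have d0: "(\<lambda>n. \<integral>\<omega>. d (X n) \<omega> powr p \<partial>M) \<longlonglongrightarrow> 0" by simp
    have pos: "0 < p" "0 < q" using \<open>1 < p\<close> q by auto
    have XL: "X n \<in> Lp M p" for n using X by blast
    have small: "AE \<omega> in M. \<forall>\<epsilon>>0. \<exists>\<delta>>0. \<forall>n. d (X n) \<omega> < \<delta> \<longrightarrow> \<phi> (X n) \<omega> \<le> \<epsilon>"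
      using \<phi>_small by eventually_elim blast
    note vanish = dominated_quotients_vanish_along_subsequence[of p q M "\<lambda>n. d (X n)" "\<lambda>n. \<phi> (X n)" h C,
      OF pos d_int[OF XL] d_nonneg d0 \<phi>_meas[OF XL] \<phi>_nonneg h_int h_nonneg \<open>0 \<le> C\<close> \<phi>_bound small]
    obtain r where r: "(\<lambda>n. \<integral>\<omega>. \<phi> (X (r n)) \<omega> powr q \<partial>M) \<longlonglongrightarrow> 0"
      using vanish(2) by (elim exE conjE) (rule that)
    have "eventually (\<lambda>n. (\<integral>\<omega>. \<phi> (X (r n)) \<omega> powr q \<partial>M) < \<epsilon> powr q) sequentially"
      using r by (rule order_tendstoD) (use that in simp)
    then obtain n where n: "(\<integral>\<omega>. \<phi> (X (r n)) \<omega> powr q \<partial>M) < \<epsilon> powr q"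
      by (auto simp: eventually_sequentially)
    have "0 < N (X (r n))" using X by blast
    from quotient[OF XL this vanish(1) n that] X show False by blast
  qed
  then have "0 \<le> Liminf (Lp_at M p x0) (\<lambda>x. (J x - J x0 - ereal (l x)) / ereal (N x))"
    unfolding le_Liminf_iff
  proof (intro allI impI)
    fix y :: ereal assume "y < 0"
    then obtain s where s: "y < ereal s" "ereal s < 0" using ereal_dense2 by blast
    assume "\<And>\<epsilon>. 0 < \<epsilon> \<Longrightarrow> eventually (\<lambda>x. ereal (- \<epsilon>) < (J x - J x0 - ereal (l x)) / ereal (N x)) (Lp_at M p x0)"
    from this[of "- s"] s(2) have "eventually (\<lambda>x. ereal s < (J x - J x0 - ereal (l x)) / ereal (N x)) (Lp_at M p x0)"
      by simp
    then show "eventually (\<lambda>x. y < (J x - J x0 - ereal (l x)) / ereal (N x)) (Lp_at M p x0)"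
      by (rule eventually_mono) (use s(1) in \<open>rule less_trans\<close>)
  qed
  then show "Lq_pairing M x' \<in> Lp_frechet_subdiff M p (integral_functional M f) x0"
    using Lq_pairing_in_Lp_dual[OF assms(3,4) x'] assms(7)
    unfolding Lp_frechet_subdiff_def J_def N_def l_def by simp
qed

end
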